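(* Consider the frozen-phase two-dimensional spin market and its wealth processes defined in the context. At epoch $T_k$ let $$D_k=\mathbf E\big[W(T_k)-W(T_{k-1})\mid\mathcal F_{k-1}\big]$$ be the conditional expected increment of aggregate market wealth, and let $$M(T_k)=\sum_{y\in Y}\mathrm{sgn}\Big(\mathbf E\big[W(y,T_k)-W(y,T_{k-1})\mid\mathcal F_{k-1}\big]\Big)$$ be the majority opinion of the agents. Then: (1) When the market experiences a supermartingale, so does the majority of the agents: if $D_k\le0$ then $M(T_k)\le0$. (2) There exist situations (choices of the model parameters and of the state at time $T_{k-1}$) in which the market disagrees with the majority of the agents, in the sense that $D_k$ and $M(T_k)$ have opposite signs. (3) When the market disagrees with the majority (that is, $D_k$ and $M(T_k)$ have opposite signs), the market is experiencing a submartingale: $D_k\ge0$.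
   Context: Parameters: integers $d\ge 1$ and $N\ge 2d+1$, reals $\alpha>0$ and $q\in(0,1]$, and a price impact function $f$ with $f(\cdot,N)$ nondecreasing in its first argument (and nonincreasing in the second), $f(0,N)=0$ and $f(1,N)>0$; $\gamma=f(-1,N)/f(1,N)\le0$. $Y$ is a finite set of $N$ agents and $\varphi:Y\to\{1,\dots,N\}$ is a fixed bijection. A state is a configuration $x\mapsto(\eta_1(x),\eta_2(x))\in\{-1,1\}^2$, $x\in Y$. The process is constant between epochs $0=T_0<T_1<T_2<\cdots$ with i.i.d. rate-1 exponential spacings; $N^+(t)$ is the number of $x\in Y$ with $\eta_1(x,t)=+1$, and $\mathcal F_{n}$ is the history (of spins and prices) up to time $T_n$. Frozen-phase (inverse temperature $\beta\to\infty$) Hamiltonian probabilities. For $0\le i\le N$ put $c=c(i)=\lceil \alpha|i/N-1/2|\rceil$. For $1\le i\le N$, $$\bar P_{++}(i)=\sum_{j=\max(d+c,\,i+2d-N)}^{\min(2d,\,i)}\binom{i-1}{j}\binom{N-i}{2d-j}\Big/\binom{N-1}{2d}$$ if $i\in[N(\tfrac12-\tfrac d\alpha),N(\tfrac12+\tfrac d\alpha)]$, and $\bar P_{++}(i)=0$ otherwise. For $0\le i\le N-1$, $$\bar P_{--}(i)=\sum_{j=\max(0,\,i+2d-N)}^{\min(d-c,\,i)}\binom{i}{j}\binom{N-i-1}{2d-j}\Big/\binom{N-1}{2d}$$ if $i$ lies in the same interval, and $\bar P_{--}(i)=0$ otherwise. Empty sums are $0$, and binomials $\binom nk$ with $k<0$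 or $k>n$ are $0$. Second spin: define $\mathcal E_+(i)=(1-\frac iN)(1-\bar P_{--}(i))+\gamma\frac iN(1-\bar P_{++}(i))$ for $1\le i\le N$ (first term $0$ when $i=N$), $\mathcal B=\{i:\mathcal E_+(i)\ge(1-\frac1q)(1-\frac iN)\}$ and $\mathcal C=\{i:\mathcal E_+(i)\le(1-\frac1q)\frac iN\}$. At each $T_n$, $n\ge1$, all sites update $\eta_2$ synchronously: if $\eta_2(x,T_{n-1})=1$, then $\eta_2(x,T_n)=1$ when $\varphi(x)\in\mathcal B$ and $-1$ otherwise; if $\eta_2(x,T_{n-1})=-1$, then $\eta_2(x,T_n)=-1$ when $\varphi(x)\in\mathcal C$ and $+1$ otherwise. First spin: at each $T_n$ an agent $J_n$ is chosen uniformly from $Y$, independently of $\mathcal F_{n-1}$, and only its first spin may flip. Given $\mathcal F_{n-1}$ with $N^+(T_{n-1})=i$, let $s=\eta_2(\varphi^{-1}(i),T_n)$ for $1\le i\le N$ (convention: $s=+1$ when $i=0$). Given moreover $J_n$: if $\eta_1(J_n,T_{n-1})=-1$, it flips to $+1$ with probability $q(1-\bar P_{--}(i))+(1-q)\frac{1+s}2$; if $\eta_1(J_n,T_{n-1})=+1$, it flips to $-1$ with probability $q(1-\bar P_{++}(i))+(1-q)\frac{1-s}2$. Put $\bar X_n=N^+(T_n)-N^+(T_{n-1})\in\{-1,0,1\}$. Price and wealth: the price $P$ is positive, with $\Delta P(T_n)=P(T_n)-P(T_{n-1})=P(T_{n-1})f(\bar X_n,N)$. The wealth of agent $y$ starts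 at a given $W(y,0)=K(y)$ and satisfies $W(y,T_n)=W(y,T_{n-1})$ if $J_n=y$, and $W(y,T_n)=W(y,T_{n-1})+\eta_1(y,T_{n-1})\,\Delta P(T_n)$ otherwise. Aggregate wealth satisfies $$W(T_k)=W(T_{k-1})+\Delta P(T_k)\big[2N^+(T_{k-1})-N+\bar X_k\big].$$ The market "experiences a supermartingale" (submartingale) at epoch $T_k$ if $D_k\le0$ ($D_k\ge 0$), and the majority of the agents does so according to the sign of $M(T_k)$. Here $\mathrm{sgn}(0)=0$. *)

theory Defs
  imports "HOL-Probability.Probability"
begin

section \<open>Frozen-phase Hamiltonian probabilities\<close>

definition agreement_threshold :: "nat \<Rightarrow> real \<Rightarrow> nat \<Rightarrow> int" where
  "agreement_threshold N \<alpha> i = \<lceil>\<alpha> * \<bar>real i / real N - 1 / 2\<bar>\<rceil>"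

definition mixed_range :: "nat \<Rightarrow> nat \<Rightarrow> real \<Rightarrow> nat set" where
  "mixed_range d N \<alpha> =
     {i. real i \<in> {real N * (1 / 2 - real d / \<alpha>) .. real N * (1 / 2 + real d / \<alpha>)}}"

text \<open>
  The summation bounds are integers, so that \<open>d - c\<close> and \<open>i + 2 d - N\<close> are not truncated.
  All indices in the ranges below lie between \<open>0\<close> and \<open>2 d\<close>, so the conversions \<^const>\<open>nat\<close> are
  harmless. The value of \<open>stay_pp\<close> at \<open>i = 0\<close> and that of \<open>stay_mm\<close> at \<open>i = N\<close> are artefacts
  of totality and never matter: in \<open>drift_plus\<close> the latter has the factor \<open>1 - i / N\<close> (and \<open>i \<ge> 1\<close>),
  and no agent can flip down when \<open>i = 0\<close>, nor up when \<open>i = N\<close>.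
\<close>

definition stay_pp :: "nat \<Rightarrow> nat \<Rightarrow> real \<Rightarrow> nat \<Rightarrow> real" where
  "stay_pp d N \<alpha> i =
     (if i \<in> mixed_range d N \<alpha> then
        (\<Sum>j = max (int d + agreement_threshold N \<alpha> i) (int i + 2 * int d - int N) .. min (2 * int d) (int i).
           real ((i - 1) choose nat j) * real ((N - i) choose nat (2 * int d - j)))
        / real ((N - 1) choose (2 * d))
      else 0)"

definition stay_mm :: "nat \<Rightarrow> nat \<Rightarrow> real \<Rightarrow> nat \<Rightarrow> real" where
  "stay_mm d N \<alpha> i =
     (if i \<in> mixed_range d N \<alpha> then
        (\<Sum>j = max 0 (int i + 2 * int d - int N) .. min (int d - agreement_threshold N \<alpha> i) (int i).
           real (i choose nat j) * real ((N - i - 1) choose nat (2 * int d - j)))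
        / real ((N - 1) choose (2 * d))
      else 0)"


section \<open>Update rules of the two spins\<close>

definition impact_ratio :: "(real \<Rightarrow> nat \<Rightarrow> real) \<Rightarrow> nat \<Rightarrow> real" where
  "impact_ratio f N = f (- 1) N / f 1 N"

definition drift_plus :: "nat \<Rightarrow> nat \<Rightarrow> real \<Rightarrow> (real \<Rightarrow> nat \<Rightarrow> real) \<Rightarrow> nat \<Rightarrow> real" where
  "drift_plus d N \<alpha> f i =
     (1 - real i / real N) * (1 - stay_mm d N \<alpha> i)
     + impact_ratio f N * (real i / real N) * (1 - stay_pp d N \<alpha> i)"

definition keep_plus_set :: "nat \<Rightarrow> nat \<Rightarrow> real \<Rightarrow> real \<Rightarrow> (real \<Rightarrow> nat \<Rightarrow> real) \<Rightarrow> nat set" where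
  "keep_plus_set d N \<alpha> q f =
     {i \<in> {1..N}. drift_plus d N \<alpha> f i \<ge> (1 - 1 / q) * (1 - real i / real N)}"

definition keep_minus_set :: "nat \<Rightarrow> nat \<Rightarrow> real \<Rightarrow> real \<Rightarrow> (real \<Rightarrow> nat \<Rightarrow> real) \<Rightarrow> nat set" where
  "keep_minus_set d N \<alpha> q f =
     {i \<in> {1..N}. drift_plus d N \<alpha> f i \<le> (1 - 1 / q) * (real i / real N)}"

definition next_spin2 ::
  "nat \<Rightarrow> nat \<Rightarrow> real \<Rightarrow> real \<Rightarrow> (real \<Rightarrow> nat \<Rightarrow> real) \<Rightarrow> nat \<Rightarrow> real \<Rightarrow> real" where
  "next_spin2 d N \<alpha> q f i e =
     (if e = 1 then (if i \<in> keep_plus_set d N \<alpha> q f then 1 else - 1)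
      else (if i \<in> keep_minus_set d N \<alpha> q f then - 1 else 1))"

definition flip_up_prob :: "nat \<Rightarrow> nat \<Rightarrow> real \<Rightarrow> real \<Rightarrow> nat \<Rightarrow> real \<Rightarrow> real" where
  "flip_up_prob d N \<alpha> q i s = q * (1 - stay_mm d N \<alpha> i) + (1 - q) * ((1 + s) / 2)"

definition flip_down_prob :: "nat \<Rightarrow> nat \<Rightarrow> real \<Rightarrow> real \<Rightarrow> nat \<Rightarrow> real \<Rightarrow> real" where
  "flip_down_prob d N \<alpha> q i s = q * (1 - stay_pp d N \<alpha> i) + (1 - q) * ((1 - s) / 2)"


section \<open>Market processes\<close>

text \<open>
  Paths are indexed by real time \<open>t \<ge> 0\<close>; \<open>epoch S n\<close> is $T_n$ and \<open>chosen S n\<close> is $J_n$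
  (relevant for \<open>n \<ge> 1\<close>).
\<close>

record ('w, 'a) spin_market =
  law :: "'w measure"
  agents :: "'a set"
  label :: "'a \<Rightarrow> nat"
  epoch :: "nat \<Rightarrow> 'w \<Rightarrow> real"
  chosen :: "nat \<Rightarrow> 'w \<Rightarrow> 'a"
  spin1 :: "'a \<Rightarrow> real \<Rightarrow> 'w \<Rightarrow> real"
  spin2 :: "'a \<Rightarrow> real \<Rightarrow> 'w \<Rightarrow> real"
  price :: "real \<Rightarrow> 'w \<Rightarrow> real"
  wealth :: "'a \<Rightarrow> real \<Rightarrow> 'w \<Rightarrow> real"

definition n_plus :: "('w, 'a) spin_market \<Rightarrow> real \<Rightarrow> 'w \<Rightarrow> nat" where
  "n_plus S t \<omega> = card {x \<in> agents S. spin1 S x t \<omega> = 1}"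

definition in_state :: "('w, 'a) spin_market \<Rightarrow> real \<Rightarrow> ('a \<Rightarrow> real) \<Rightarrow> ('a \<Rightarrow> real) \<Rightarrow> 'w \<Rightarrow> bool" where
  "in_state S t e1 e2 \<omega> \<longleftrightarrow> (\<forall>y\<in>agents S. spin1 S y t \<omega> = e1 y \<and> spin2 S y t \<omega> = e2 y)"

text \<open>
  The history up to the random time $T_n$ is generated by the spins and prices stopped at $T_n$.
\<close>

definition history :: "('w, 'a) spin_market \<Rightarrow> nat \<Rightarrow> 'w measure" where
  "history S n = sigma (space (law S))
     {(\<lambda>\<omega>. Z (min t (epoch S n \<omega>)) \<omega>) -` B \<inter> space (law S) | Z t B.
        Z \<in> spin1 S ` agents S \<union> spin2 S ` agents S \<union> {price S} \<and> 0 \<le> t \<and> B \<in> sets borel}"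

definition choice_events :: "('w, 'a) spin_market \<Rightarrow> nat \<Rightarrow> 'w set set" where
  "choice_events S n = {chosen S n -` A \<inter> space (law S) | A. A \<subseteq> agents S}"

definition history_choice :: "('w, 'a) spin_market \<Rightarrow> nat \<Rightarrow> 'w measure" where
  "history_choice S n =
     sigma (space (law S)) (sets (history S n) \<union> choice_events S (Suc n))"

definition net_flip :: "('w, 'a) spin_market \<Rightarrow> nat \<Rightarrow> 'w \<Rightarrow> real" where
  "net_flip S n \<omega> = real (n_plus S (epoch S n \<omega>) \<omega>) - real (n_plus S (epoch S (n - 1) \<omega>) \<omega>)"

definition flip_event :: "('w, 'a) spin_market \<Rightarrow> nat \<Rightarrow> 'w set" where
  "flip_event S n =
     {\<omega> \<in> space (law S). spin1 S (chosen S n \<omega>) (epoch S n \<omega>) \<omega>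
                       \<noteq> spin1 S (chosen S n \<omega>) (epoch S (n - 1) \<omega>) \<omega>}"

text \<open>The second spin, at time $T_n$, of the site labelled $N^+(T_{n-1})$.\<close>

definition consulted_spin2 :: "('w, 'a) spin_market \<Rightarrow> nat \<Rightarrow> 'w \<Rightarrow> real" where
  "consulted_spin2 S n \<omega> =
     (let i = n_plus S (epoch S (n - 1) \<omega>) \<omega>
      in if i = 0 then 1
         else spin2 S (inv_into (agents S) (label S) i) (epoch S n \<omega>) \<omega>)"

definition flip_prob :: "nat \<Rightarrow> nat \<Rightarrow> real \<Rightarrow> real \<Rightarrow> ('w, 'a) spin_market \<Rightarrow> nat \<Rightarrow> 'w \<Rightarrow> real" where
  "flip_prob d N \<alpha> q S n \<omega> =
     (let i = n_plus S (epoch S (n - 1) \<omega>) \<omega>; s = consulted_spin2 S n \<omega>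
      in if spin1 S (chosen S n \<omega>) (epoch S (n - 1) \<omega>) \<omega> = - 1
         then flip_up_prob d N \<alpha> q i s else flip_down_prob d N \<alpha> q i s)"

definition piecewise_constant :: "('w, 'a) spin_market \<Rightarrow> (real \<Rightarrow> 'w \<Rightarrow> real) \<Rightarrow> bool" where
  "piecewise_constant S Z \<longleftrightarrow>
     (\<forall>\<omega> \<in> space (law S). \<forall>n t.
        epoch S n \<omega> \<le> t \<and> t < epoch S (Suc n) \<omega> \<longrightarrow> Z t \<omega> = Z (epoch S n \<omega>) \<omega>)"

locale frozen_market =
  fixes d N :: nat and \<alpha> q :: real and f :: "real \<Rightarrow> nat \<Rightarrow> real"
    and K :: "'a \<Rightarrow> real" and S :: "('w, 'a) spin_market"
  assumes d_pos: "1 \<le> d"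
    and N_large: "2 * d + 1 \<le> N"
    and alpha_pos: "0 < \<alpha>"
    and q_pos: "0 < q" and q_le_1: "q \<le> 1"
    and impact_mono: "mono (\<lambda>x. f x N)"
    and impact_antimono: "\<And>x. antimono_on {1..} (f x)"
    and impact_0: "f 0 N = 0" and impact_1: "0 < f 1 N"
    and finite_agents: "finite (agents S)"
    and card_agents: "card (agents S) = N"
    and label_bij: "bij_betw (label S) (agents S) {1..N}"
    and prob_space_law: "prob_space (law S)"
    and epoch_0: "\<And>\<omega>. \<omega> \<in> space (law S) \<Longrightarrow> epoch S 0 \<omega> = 0"
    and epoch_less: "\<And>n \<omega>. \<omega> \<in> space (law S) \<Longrightarrow> epoch S n \<omega> < epoch S (Suc n) \<omega>"
    and spacing_exponential:
      "\<And>n. distributed (law S) lborel (\<lambda>\<omega>. epoch S (Suc n) \<omega> - epoch S n \<omega>) (exponential_density 1)"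
    and spacing_indep:
      "prob_space.indep_vars (law S) (\<lambda>_. borel) (\<lambda>n \<omega>. epoch S (Suc n) \<omega> - epoch S n \<omega>) UNIV"
    and spin1_rv: "\<And>y n. y \<in> agents S \<Longrightarrow> (\<lambda>\<omega>. spin1 S y (epoch S n \<omega>) \<omega>) \<in> borel_measurable (law S)"
    and spin2_rv: "\<And>y n. y \<in> agents S \<Longrightarrow> (\<lambda>\<omega>. spin2 S y (epoch S n \<omega>) \<omega>) \<in> borel_measurable (law S)"
    and price_rv: "\<And>n. (\<lambda>\<omega>. price S (epoch S n \<omega>) \<omega>) \<in> borel_measurable (law S)"
    and spin1_pc: "\<And>y. y \<in> agents S \<Longrightarrow> piecewise_constant S (spin1 S y)"
    and spin2_pc: "\<And>y. y \<in> agents S \<Longrightarrow> piecewise_constant S (spin2 S y)"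
    and price_pc: "piecewise_constant S (price S)"
    and wealth_pc: "\<And>y. y \<in> agents S \<Longrightarrow> piecewise_constant S (wealth S y)"
    and spin1_values: "\<And>y n \<omega>. y \<in> agents S \<Longrightarrow> \<omega> \<in> space (law S) \<Longrightarrow>
      spin1 S y (epoch S n \<omega>) \<omega> \<in> {- 1, 1}"
    and spin2_values: "\<And>y n \<omega>. y \<in> agents S \<Longrightarrow> \<omega> \<in> space (law S) \<Longrightarrow>
      spin2 S y (epoch S n \<omega>) \<omega> \<in> {- 1, 1}"
    and spin2_step: "\<And>y n \<omega>. y \<in> agents S \<Longrightarrow> \<omega> \<in> space (law S) \<Longrightarrow>
      spin2 S y (epoch S (Suc n) \<omega>) \<omega> =
        next_spin2 d N \<alpha> q f (label S y) (spin2 S y (epoch S n \<omega>) \<omega>)"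
    and chosen_rv: "\<And>n. chosen S (Suc n) \<in> measurable (law S) (count_space (agents S))"
    and chosen_uniform: "\<And>n. distr (law S) (count_space (agents S)) (chosen S (Suc n))
      = uniform_count_measure (agents S)"
    and chosen_indep:
      "\<And>n. prob_space.indep_set (law S) (sets (history S n)) (choice_events S (Suc n))"
    and spin1_others: "\<And>y n \<omega>. y \<in> agents S \<Longrightarrow> \<omega> \<in> space (law S) \<Longrightarrow> y \<noteq> chosen S (Suc n) \<omega> \<Longrightarrow>
      spin1 S y (epoch S (Suc n) \<omega>) \<omega> = spin1 S y (epoch S n \<omega>) \<omega>"
    and spin1_flip: "\<And>n. AE \<omega> in law S.
      real_cond_exp (law S) (history_choice S n) (indicator (flip_event S (Suc n))) \<omega>
        = flip_prob d N \<alpha> q S (Suc n) \<omega>"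
    and price_pos: "\<And>n \<omega>. \<omega> \<in> space (law S) \<Longrightarrow> 0 < price S (epoch S n \<omega>) \<omega>"
    and price_step: "\<And>n \<omega>. \<omega> \<in> space (law S) \<Longrightarrow>
      price S (epoch S (Suc n) \<omega>) \<omega> - price S (epoch S n \<omega>) \<omega>
        = price S (epoch S n \<omega>) \<omega> * f (net_flip S (Suc n) \<omega>) N"
    and wealth_0: "\<And>y \<omega>. y \<in> agents S \<Longrightarrow> \<omega> \<in> space (law S) \<Longrightarrow> wealth S y 0 \<omega> = K y"
    and wealth_step: "\<And>y n \<omega>. y \<in> agents S \<Longrightarrow> \<omega> \<in> space (law S) \<Longrightarrow>
      wealth S y (epoch S (Suc n) \<omega>) \<omega> =
        (if chosen S (Suc n) \<omega> = y then wealth S y (epoch S n \<omega>) \<omega>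
         else wealth S y (epoch S n \<omega>) \<omega> + spin1 S y (epoch S n \<omega>) \<omega>
                * (price S (epoch S (Suc n) \<omega>) \<omega> - price S (epoch S n \<omega>) \<omega>))"


section \<open>Conditional increments of wealth\<close>

definition market_wealth :: "('w, 'a) spin_market \<Rightarrow> real \<Rightarrow> 'w \<Rightarrow> real" where
  "market_wealth S t \<omega> = (\<Sum>y\<in>agents S. wealth S y t \<omega>)"

text \<open>
  Both quantities are meant for \<open>k \<ge> 1\<close>. As versions of conditional expectations they are
  determined up to null sets only. No integrability of the initial price is needed: each wealth
  increment is the product of the price at $T_{k-1}$, which is positive and known at that time,
  with a bounded variable.
\<close>

definition market_drift :: "('w, 'a) spin_market \<Rightarrow> nat \<Rightarrow> 'w \<Rightarrow> real" where
  "market_drift S k =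
     real_cond_exp (law S) (history S (k - 1))
       (\<lambda>\<omega>. market_wealth S (epoch S k \<omega>) \<omega> - market_wealth S (epoch S (k - 1) \<omega>) \<omega>)"

definition majority_opinion :: "('w, 'a) spin_market \<Rightarrow> nat \<Rightarrow> 'w \<Rightarrow> real" where
  "majority_opinion S k \<omega> =
     (\<Sum>y\<in>agents S. sgn (real_cond_exp (law S) (history S (k - 1))
        (\<lambda>\<omega>'. wealth S y (epoch S k \<omega>') \<omega>' - wealth S y (epoch S (k - 1) \<omega>') \<omega>') \<omega>))"

definition opposite_signs :: "real \<Rightarrow> real \<Rightarrow> bool" where
  "opposite_signs a b \<longleftrightarrow> a < 0 \<and> 0 < b \<or> 0 < a \<and> b < 0"

text \<open>The recursion for the aggregate wealth follows from those of the individual agents.\<close>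

lemma (in frozen_market) market_wealth_step:
  assumes "\<omega> \<in> space (law S)"
  shows "market_wealth S (epoch S (Suc n) \<omega>) \<omega> = market_wealth S (epoch S n \<omega>) \<omega>
    + (price S (epoch S (Suc n) \<omega>) \<omega> - price S (epoch S n \<omega>) \<omega>)
      * (2 * real (n_plus S (epoch S n \<omega>) \<omega>) - real N + net_flip S (Suc n) \<omega>)"
proof -
  let ?Y = "agents S" and ?j = "chosen S (Suc n) \<omega>"
  let ?a = "\<lambda>y. spin1 S y (epoch S n \<omega>) \<omega>" and ?b = "\<lambda>y. spin1 S y (epoch S (Suc n) \<omega>) \<omega>"
  let ?D = "price S (epoch S (Suc n) \<omega>) \<omega> - price S (epoch S n \<omega>) \<omega>"
  have j: "?j \<in> ?Y"
    using chosen_rv[of n] assms by (metis measurable_space space_count_space)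
  have two_card: "2 * real (card {x \<in> ?Y. h x = 1}) - real N = sum h ?Y"
    if "\<And>x. x \<in> ?Y \<Longrightarrow> h x \<in> {- 1, 1}" for h :: "'a \<Rightarrow> real"
  proof -
    have "sum h ?Y = (\<Sum>x\<in>?Y. 2 * of_bool (h x = 1) - 1)"
      using that by (intro sum.cong) auto
    also have "\<dots> = 2 * (\<Sum>x\<in>?Y. of_bool (h x = 1)) - real N"
      using finite_agents by (simp add: sum_subtractf card_agents sum_distrib_left del: sum_of_bool_eq)
    also have "(\<Sum>x\<in>?Y. of_bool (h x = 1)) = real (card {x \<in> ?Y. h x = 1})"
      using finite_agents by (simp add: Int_def)
    finally show ?thesis by simp
  qed
  have a: "2 * real (n_plus S (epoch S n \<omega>) \<omega>) - real N = sum ?a ?Y"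
    unfolding n_plus_def by (rule two_card) (use spin1_values assms in blast)
  have b: "2 * real (n_plus S (epoch S (Suc n) \<omega>) \<omega>) - real N = sum ?b ?Y"
    unfolding n_plus_def by (rule two_card) (use spin1_values assms in blast)
  have rest: "sum ?b (?Y - {?j}) = sum ?a (?Y - {?j})"
    using spin1_others assms by (intro sum.cong) auto
  have net: "2 * net_flip S (Suc n) \<omega> = ?b ?j - ?a ?j"
    using a b rest sum.remove[OF finite_agents j, of ?a] sum.remove[OF finite_agents j, of ?b]
    by (simp add: net_flip_def)
  have stay: "?D = 0" if "?b ?j = ?a ?j"
    using net that price_step[OF assms, of n] impact_0 by simp
  have key: "?D * (sum ?a ?Y + net_flip S (Suc n) \<omega>) = ?D * sum ?a (?Y - {?j})"
  proof (cases "?b ?j = ?a ?j")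
    case False
    then have "net_flip S (Suc n) \<omega> = - ?a ?j"
      using net spin1_values[OF j assms, of n] spin1_values[OF j assms, of "Suc n"] by auto
    then show ?thesis using sum.remove[OF finite_agents j, of ?a] by simp
  qed (use stay in simp)
  have "market_wealth S (epoch S (Suc n) \<omega>) \<omega>
      = (\<Sum>y\<in>?Y. wealth S y (epoch S n \<omega>) \<omega> + (if y = ?j then 0 else ?a y * ?D))"
    unfolding market_wealth_def using wealth_step assms by (intro sum.cong) auto
  also have "\<dots> = market_wealth S (epoch S n \<omega>) \<omega> + (\<Sum>y\<in>?Y. if y = ?j then 0 else ?a y * ?D)"
    by (simp add: sum.distrib market_wealth_def)
  also have "(\<Sum>y\<in>?Y. if y = ?j then 0 else ?a y * ?D) = (\<Sum>y\<in>?Y - {?j}. ?a y * ?D)"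
    using finite_agents by (intro sum.mono_neutral_cong_right) auto
  also have "\<dots> = ?D * sum ?a (?Y - {?j})"
    by (simp add: sum_distrib_left mult.commute)
  finally show ?thesis unfolding a key .
qed

end

theory Submission
  imports Defs
begin

text \<open>
  The wealth increment of an agent at an epoch is the price before the epoch, times its own first
  spin, times the relative price change, provided that it is not the agent chosen to flip. Since
  the choice is uniform and independent of the past, the conditional expectation of this increment
  is explicit (lemma \<open>agent_drift\<close>): up to the positive factor price over \<open>N\<close>, it is the agent's
  spin times the sum, over all other agents \<open>j\<close>, of the flip probability of \<open>j\<close> times the price
  response to that flip. Market drift and majority opinion thus become the sum of these expected
  gains and the sum of their signs.

  Given the state, the expected gain depends only on the agent's first spin: \<open>A\<close> for buyers, \<open>B\<close>
  for sellers. If the sum ran over all agents, \<open>A\<close> and \<open>B\<close> would be opposite numbers. Leaving out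
  the agent's own flip, which would always move the price against its position, adds something
  nonnegative to either, whence \<open>A + B \<ge> 0\<close> (lemma \<open>majority_follows_market\<close>). For \<open>p\<close> buyers and
  \<open>m\<close> sellers, an elementary argument then shows that \<open>p * A + m * B \<le> 0\<close> implies
  \<open>p * sgn A + m * sgn B \<le> 0\<close> (lemma \<open>weighted_sgn_nonpos\<close>). This is the first claim, and the third
  follows from it: a market with negative drift cannot have a majority of positive opinion.

  For the second claim, three agents suffice, two of them buyers, in a regime where the chosen agent
  flips with certainty and prices fall by more than they rise. The market is built on an
  infinite product space: waiting times and choices are read off the coordinates, and the choice is
  independent of the history because they depend on disjoint sets of coordinates.
\<close>

section \<open>Paths stopped at an epoch\<close>

text \<open>
  Measurability at the epochs suffices, without joint measurability in time and outcome: a path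
  stopped at the later of two consecutive epochs agrees with the one stopped at the earlier, as long
  as the later epoch has not passed by time \<open>t\<close>. The \<open>\<sigma>\<close>-algebra
  \<open>A\<close> is left free, so that the same induction places the history both inside the full
  \<open>\<sigma>\<close>-algebra and, in the example below, inside the one of the first \<open>n\<close> coordinates.
\<close>

lemma stopped_measurable:
  fixes Z :: "real \<Rightarrow> 'w \<Rightarrow> real" and S :: "('w, 'a) spin_market"
  assumes pc: "piecewise_constant S Z"
    and start: "\<And>\<omega>. \<omega> \<in> space (law S) \<Longrightarrow> epoch S 0 \<omega> = 0"
    and space_A: "space A = space (law S)"
    and "\<And>m. m \<le> n \<Longrightarrow> epoch S m \<in> borel_measurable A"
    and "\<And>m. m \<le> n \<Longrightarrow> (\<lambda>\<omega>. Z (epoch S m \<omega>) \<omega>) \<in> borel_measurable A"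
    and t: "0 \<le> t"
  shows "(\<lambda>\<omega>. Z (min t (epoch S n \<omega>)) \<omega>) \<in> borel_measurable A"
  using assms(4,5)
proof (induction n)
  case 0
  then have "(\<lambda>\<omega>. Z (epoch S 0 \<omega>) \<omega>) \<in> borel_measurable A" by simp
  then show ?case
    by (rule measurable_cong[THEN iffD2, rotated]) (use start space_A t in simp)
next
  case (Suc n)
  have [measurable]: "(\<lambda>\<omega>. Z (min t (epoch S n \<omega>)) \<omega>) \<in> borel_measurable A"
    "epoch S (Suc n) \<in> borel_measurable A" "(\<lambda>\<omega>. Z (epoch S (Suc n) \<omega>) \<omega>) \<in> borel_measurable A"
    using Suc by auto
  have "(\<lambda>\<omega>. if t < epoch S (Suc n) \<omega> then Z (min t (epoch S n \<omega>)) \<omega> else Z (epoch S (Suc n) \<omega>) \<omega>)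
      \<in> borel_measurable A"
    by measurable
  then show ?case
  proof (rule measurable_cong[THEN iffD2, rotated])
    fix \<omega> assume "\<omega> \<in> space A"
    then have "epoch S n \<omega> \<le> t \<Longrightarrow> t < epoch S (Suc n) \<omega> \<Longrightarrow> Z t \<omega> = Z (epoch S n \<omega>) \<omega>"
      using pc space_A unfolding piecewise_constant_def by blast
    then show "Z (min t (epoch S (Suc n) \<omega>)) \<omega> =
        (if t < epoch S (Suc n) \<omega> then Z (min t (epoch S n \<omega>)) \<omega> else Z (epoch S (Suc n) \<omega>) \<omega>)"
      by (auto simp: min_def)
  qed
qed

lemma history_subset:
  fixes S :: "('w, 'a) spin_market"
  assumes pc: "\<And>Z. Z \<in> spin1 S ` agents S \<union> spin2 S ` agents S \<union> {price S} \<Longrightarrow> piecewise_constant S Z"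
    and start: "\<And>\<omega>. \<omega> \<in> space (law S) \<Longrightarrow> epoch S 0 \<omega> = 0"
    and space_A: "space A = space (law S)"
    and epoch_A: "\<And>m. m \<le> n \<Longrightarrow> epoch S m \<in> borel_measurable A"
    and Z_A: "\<And>m Z. m \<le> n \<Longrightarrow> Z \<in> spin1 S ` agents S \<union> spin2 S ` agents S \<union> {price S} \<Longrightarrow>
      (\<lambda>\<omega>. Z (epoch S m \<omega>) \<omega>) \<in> borel_measurable A"
  shows "sets (history S n) \<subseteq> sets A"
proof -
  have "(\<lambda>\<omega>. Z (min t (epoch S n \<omega>)) \<omega>) -` B \<inter> space (law S) \<in> sets A"
    if "Z \<in> spin1 S ` agents S \<union> spin2 S ` agents S \<union> {price S}" "0 \<le> t" "B \<in> sets borel" for Z t B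
    using measurable_sets[OF stopped_measurable[OF pc[OF that(1)] start space_A epoch_A Z_A[OF _ that(1)] that(2)] that(3)]
    unfolding space_A by simp
  then have "sigma_sets (space A) {(\<lambda>\<omega>. Z (min t (epoch S n \<omega>)) \<omega>) -` B \<inter> space (law S) | Z t B.
        Z \<in> spin1 S ` agents S \<union> spin2 S ` agents S \<union> {price S} \<and> 0 \<le> t \<and> B \<in> sets borel} \<subseteq> sets A"
    by (intro sets.sigma_sets_subset) blast
  then show ?thesis
    unfolding history_def space_A by (subst sets_measure_of) auto
qed

lemma space_history [simp]: "space (history S n) = space (law S)"
  by (simp add: history_def space_measure_of_conv)

lemma space_history_choice [simp]: "space (history_choice S n) = space (law S)"
  by (simp add: history_choice_def space_measure_of_conv)

text \<open>
  The history is generated by the variables observed at deterministic times \<open>t\<close>, stopped at the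
  epoch. Letting \<open>t\<close> tend to infinity along the integers yields the value at the epoch itself.
\<close>

lemma history_measurable:
  assumes Z: "Z \<in> spin1 S ` agents S \<union> spin2 S ` agents S \<union> {price S}"
  shows "(\<lambda>\<omega>. Z (epoch S n \<omega>) \<omega>) \<in> borel_measurable (history S n)"
proof (rule borel_measurable_LIMSEQ_real)
  show "(\<lambda>\<omega>. Z (min (real m) (epoch S n \<omega>)) \<omega>) \<in> borel_measurable (history S n)" for m
  proof (rule measurableI)
    fix B :: "real set" assume "B \<in> sets borel"
    then show "(\<lambda>\<omega>. Z (min (real m) (epoch S n \<omega>)) \<omega>) -` B \<inter> space (history S n) \<in> sets (history S n)"
      unfolding space_history unfolding history_def using Z
      by (subst sets_measure_of) (auto intro!: sigma_sets.Basic exI[of _ Z] exI[of _ "real m"] exI[of _ B])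
  qed simp
  fix \<omega>
  have "eventually (\<lambda>m. epoch S n \<omega> \<le> real m) sequentially"
    using eventually_ge_at_top[of "nat \<lceil>epoch S n \<omega>\<rceil>"] by eventually_elim linarith
  then show "(\<lambda>m. Z (min (real m) (epoch S n \<omega>)) \<omega>) \<longlonglongrightarrow> Z (epoch S n \<omega>) \<omega>"
    by (intro tendsto_eventually) (auto elim!: eventually_mono simp: min_def)
qed

lemma history_subset_choice: "sets (history S n) \<subseteq> sets (history_choice S n)"
proof -
  have "sets (history S n) \<union> choice_events S (Suc n) \<subseteq> Pow (space (law S))"
    using sets.sets_into_space[of _ "history S n"] by (auto simp: choice_events_def)
  then show ?thesis unfolding history_choice_def by (auto simp: sets_measure_of)
qed

lemma choice_event_in_history_choice:
  assumes "E \<in> choice_events S (Suc n)"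
  shows "E \<in> sets (history_choice S n)"
proof -
  have "sets (history S n) \<union> choice_events S (Suc n) \<subseteq> Pow (space (law S))"
    using sets.sets_into_space[of _ "history S n"] by (auto simp: choice_events_def)
  then show ?thesis unfolding history_choice_def using assms by (auto simp: sets_measure_of)
qed

text \<open>
  A nonnegative known factor can be taken out even if the product is not integrable, because the
  positive and the negative part of the conditional expectation scale separately. This is what
  handles the price, about whose moments nothing is known.
\<close>

lemma (in sigma_finite_subalgebra) real_cond_exp_mult_nonneg:
  assumes p: "p \<in> borel_measurable F" and p0: "\<And>x. x \<in> space M \<Longrightarrow> 0 \<le> p x"
    and g: "g \<in> borel_measurable M"
  shows "AE x in M. real_cond_exp M F (\<lambda>x. p x * g x) x = p x * real_cond_exp M F g x"
proof -
  have pM: "p \<in> borel_measurable M" by (rule measurable_from_subalg[OF subalg p])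
  have *: "AE x in M. nn_cond_exp M F (\<lambda>x. ennreal (p x * h x)) x = ennreal (p x) * nn_cond_exp M F (\<lambda>x. ennreal (h x)) x"
    if h: "h \<in> borel_measurable M" for h
  proof -
    have "AE x in M. nn_cond_exp M F (\<lambda>x. ennreal (p x * h x)) x = nn_cond_exp M F (\<lambda>x. ennreal (p x) * ennreal (h x)) x"
      by (rule nn_cond_exp_cong) (use p0 pM h in \<open>auto simp: ennreal_mult'\<close>)
    moreover have "AE x in M. ennreal (p x) * nn_cond_exp M F (\<lambda>x. ennreal (h x)) x
        = nn_cond_exp M F (\<lambda>x. ennreal (p x) * ennreal (h x)) x"
      by (rule nn_cond_exp_prod) (use p h in auto)
    ultimately show ?thesis by eventually_elim simp
  qed
  have "AE x in M. x \<in> space M" by simp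
  with *[OF g] *[of "\<lambda>x. - g x"] g show ?thesis
    unfolding real_cond_exp_def
    by (auto simp: enn2real_mult p0 algebra_simps)
qed

section \<open>Conditional expectation of the wealth increments\<close>

text \<open>
  The probability with which \<open>j\<close> would flip if it were chosen. Naming the site, instead of
  referring to the random choice, makes this a function of the history.
\<close>

definition site_flip_prob ::
  "nat \<Rightarrow> nat \<Rightarrow> real \<Rightarrow> real \<Rightarrow> ('w, 'a) spin_market \<Rightarrow> nat \<Rightarrow> 'a \<Rightarrow> 'w \<Rightarrow> real" where
  "site_flip_prob d N \<alpha> q S n j \<omega> =
     (let i = n_plus S (epoch S n \<omega>) \<omega>; s = consulted_spin2 S (Suc n) \<omega>
      in if spin1 S j (epoch S n \<omega>) \<omega> = - 1
         then flip_up_prob d N \<alpha> q i s else flip_down_prob d N \<alpha> q i s)"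

text \<open>
  The relative price change caused by a flip of agent \<open>j\<close>: a seller (spin \<open>- 1\<close>) turning buyer
  raises the number of buyers by one, a buyer turning seller lowers it by one.
\<close>

definition price_response ::
  "nat \<Rightarrow> (real \<Rightarrow> nat \<Rightarrow> real) \<Rightarrow> ('w, 'a) spin_market \<Rightarrow> nat \<Rightarrow> 'a \<Rightarrow> 'w \<Rightarrow> real" where
  "price_response N f S n j \<omega> = (if spin1 S j (epoch S n \<omega>) \<omega> = - 1 then f 1 N else f (- 1) N)"

definition choice_flip :: "('w, 'a) spin_market \<Rightarrow> nat \<Rightarrow> 'a \<Rightarrow> 'w set" where
  "choice_flip S n j = {\<omega> \<in> flip_event S (Suc n). chosen S (Suc n) \<omega> = j}"

context frozen_market
begin

sublocale prob_space "law S" by (rule prob_space_law)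

lemma N_pos: "0 < N" using N_large by simp

lemma epoch_rv: "epoch S n \<in> borel_measurable (law S)"
proof (induction n)
  case 0
  have "(\<lambda>_. 0 :: real) \<in> borel_measurable (law S)" by simp
  then show ?case by (rule measurable_cong[THEN iffD2, rotated]) (simp add: epoch_0)
next
  case (Suc n)
  have "(\<lambda>\<omega>. epoch S (Suc n) \<omega> - epoch S n \<omega>) \<in> borel_measurable (law S)"
    using distributed_measurable[OF spacing_exponential[of n]] by simp
  then have "(\<lambda>\<omega>. (epoch S (Suc n) \<omega> - epoch S n \<omega>) + epoch S n \<omega>) \<in> borel_measurable (law S)"
    using Suc by (intro borel_measurable_add)
  then show ?case by simp
qed

lemma subalgebra_history: "subalgebra (law S) (history S n)"
  unfolding subalgebra_def
proof
  show "sets (history S n) \<subseteq> sets (law S)"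
    by (rule history_subset) (auto intro: spin1_pc spin2_pc price_pc epoch_0 epoch_rv spin1_rv spin2_rv price_rv)
qed simp

lemma choice_event_sets:
  assumes "E \<in> choice_events S (Suc n)"
  shows "E \<in> sets (law S)"
  using assms measurable_sets[OF chosen_rv[of n]] by (auto simp: choice_events_def)

lemma subalgebra_history_choice: "subalgebra (law S) (history_choice S n)"
  unfolding subalgebra_def
proof
  have "sets (history S n) \<union> choice_events S (Suc n) \<subseteq> sets (law S)"
    using choice_event_sets subalgebra_history by (auto simp: subalgebra_def)
  then have "sigma_sets (space (law S)) (sets (history S n) \<union> choice_events S (Suc n)) \<subseteq> sets (law S)"
    by (rule sets.sigma_sets_subset)
  moreover have "sets (history S n) \<union> choice_events S (Suc n) \<subseteq> Pow (space (law S))"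
    using sets.sets_into_space[of _ "history S n"] by (auto simp: choice_events_def)
  ultimately show "sets (history_choice S n) \<subseteq> sets (law S)"
    unfolding history_choice_def by (subst sets_measure_of)
qed simp

lemma subalgebra_history_in_choice: "subalgebra (history_choice S n) (history S n)"
  unfolding subalgebra_def using history_subset_choice[of S n] by simp

lemma sfs_history: "sigma_finite_subalgebra (law S) (history S n)"
  by (intro finite_measure_subalgebra_is_sigma_finite finite_measure_subalgebra.intro
      finite_measure_subalgebra_axioms.intro subalgebra_history finite_measure_axioms)

lemma sfs_history_choice: "sigma_finite_subalgebra (law S) (history_choice S n)"
  by (intro finite_measure_subalgebra_is_sigma_finite finite_measure_subalgebra.intro
      finite_measure_subalgebra_axioms.intro subalgebra_history_choice finite_measure_axioms)

lemma spin1_history: "y \<in> agents S \<Longrightarrow> (\<lambda>\<omega>. spin1 S y (epoch S n \<omega>) \<omega>) \<in> borel_measurable (history S n)"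
  by (rule history_measurable) auto

lemma spin2_history: "y \<in> agents S \<Longrightarrow> (\<lambda>\<omega>. spin2 S y (epoch S n \<omega>) \<omega>) \<in> borel_measurable (history S n)"
  by (rule history_measurable) auto

lemma price_history: "(\<lambda>\<omega>. price S (epoch S n \<omega>) \<omega>) \<in> borel_measurable (history S n)"
  by (rule history_measurable) auto

lemma n_plus_le: "n_plus S t \<omega> \<le> N"
  unfolding n_plus_def using finite_agents card_agents by (metis (lifting) card_mono mem_Collect_eq subsetI)

lemma n_plus_history: "(\<lambda>\<omega>. n_plus S (epoch S n \<omega>) \<omega>) \<in> measurable (history S n) (count_space UNIV)"
proof -
  note spin1_history[measurable] finite_agents[simp]
  have [measurable]: "{\<omega> \<in> space (history S n). spin1 S x (epoch S n \<omega>) \<omega> = 1} \<in> sets (history S n)"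
    if "x \<in> agents S" for x using spin1_history[OF that] by measurable
  have "(\<lambda>\<omega>. \<Sum>x\<in>agents S. if spin1 S x (epoch S n \<omega>) \<omega> = 1 then 1 else 0 :: nat)
      \<in> measurable (history S n) (count_space UNIV)"
    by measurable
  moreover have "n_plus S (epoch S n \<omega>) \<omega> = (\<Sum>x\<in>agents S. if spin1 S x (epoch S n \<omega>) \<omega> = 1 then 1 else 0)" for \<omega>
    unfolding n_plus_def by (simp add: sum.If_cases Int_def)
  ultimately show ?thesis by simp
qed

lemma labelled_agent:
  assumes "1 \<le> i" "i \<le> N"
  shows "inv_into (agents S) (label S) i \<in> agents S"
  using label_bij assms by (intro inv_into_into) (auto simp: bij_betw_def)

text \<open>
  The consulted second spin is the one after the update at the new epoch, yet it belongs to the old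
  history, since the second spins are updated deterministically. The site to be read off is itself
  random; it ranges over countably many values, one measurable function for each.
\<close>

lemma consulted_spin2_history: "consulted_spin2 S (Suc n) \<in> borel_measurable (history S n)"
proof -
  define site where "site i = inv_into (agents S) (label S) i" for i
  have "(\<lambda>\<omega>. if i = 0 \<or> N < i then 1
      else next_spin2 d N \<alpha> q f (label S (site i)) (spin2 S (site i) (epoch S n \<omega>) \<omega>))
      \<in> borel_measurable (history S n)" for i
  proof (cases "i = 0 \<or> N < i")
    case False
    then have [measurable]: "(\<lambda>\<omega>. spin2 S (site i) (epoch S n \<omega>) \<omega>) \<in> borel_measurable (history S n)"
      using labelled_agent[of i] unfolding site_def by (intro spin2_history) simp
    show ?thesis unfolding next_spin2_def by measurable
  qed simp
  from measurable_compose_countable[OF this n_plus_history]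
  show ?thesis
  proof (rule measurable_cong[THEN iffD2, rotated])
    fix \<omega> assume "\<omega> \<in> space (history S n)"
    then show "consulted_spin2 S (Suc n) \<omega> = (if n_plus S (epoch S n \<omega>) \<omega> = 0 \<or> N < n_plus S (epoch S n \<omega>) \<omega> then 1
      else next_spin2 d N \<alpha> q f (label S (site (n_plus S (epoch S n \<omega>) \<omega>)))
         (spin2 S (site (n_plus S (epoch S n \<omega>) \<omega>)) (epoch S n \<omega>) \<omega>))"
      using n_plus_le[of "epoch S n \<omega>" \<omega>] labelled_agent[of "n_plus S (epoch S n \<omega>) \<omega>"]
      by (auto simp: consulted_spin2_def Let_def site_def spin2_step)
  qed
qed

lemma site_flip_prob_history:
  assumes "j \<in> agents S"
  shows "site_flip_prob d N \<alpha> q S n j \<in> borel_measurable (history S n)"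
proof -
  note [measurable] = spin1_history[OF assms] consulted_spin2_history n_plus_history
  have [measurable]: "(\<lambda>\<omega>. h (n_plus S (epoch S n \<omega>) \<omega>)) \<in> borel_measurable (history S n)" for h :: "nat \<Rightarrow> real"
    using n_plus_history by measurable
  show ?thesis
    unfolding site_flip_prob_def[abs_def] Let_def flip_up_prob_def flip_down_prob_def by measurable
qed

lemma price_response_history:
  assumes "j \<in> agents S"
  shows "price_response N f S n j \<in> borel_measurable (history S n)"
proof -
  note [measurable] = spin1_history[OF assms]
  show ?thesis unfolding price_response_def[abs_def] by measurable
qed

lemma chosen_agent: "\<omega> \<in> space (law S) \<Longrightarrow> chosen S (Suc n) \<omega> \<in> agents S"
  using chosen_rv[of n] by (metis measurable_space space_count_space)

lemma choice_event: "{\<omega> \<in> space (law S). chosen S (Suc n) \<omega> = j} \<in> choice_events S (Suc n)"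
  if "j \<in> agents S" for j
  using that unfolding choice_events_def by (intro CollectI exI[of _ "{j}"]) auto

lemma flip_event_sets: "flip_event S (Suc n) \<in> sets (law S)"
proof -
  have "{\<omega> \<in> space (law S). chosen S (Suc n) \<omega> = j} \<inter>
      {\<omega> \<in> space (law S). spin1 S j (epoch S (Suc n) \<omega>) \<omega> \<noteq> spin1 S j (epoch S n \<omega>) \<omega>} \<in> sets (law S)"
    if j: "j \<in> agents S" for j
  proof -
    note [measurable] = spin1_rv[OF j] choice_event_sets[OF choice_event[OF j]]
    show ?thesis by measurable
  qed
  then have "(\<Union>j\<in>agents S. {\<omega> \<in> space (law S). chosen S (Suc n) \<omega> = j} \<inter>
      {\<omega> \<in> space (law S). spin1 S j (epoch S (Suc n) \<omega>) \<omega> \<noteq> spin1 S j (epoch S n \<omega>) \<omega>}) \<in> sets (law S)"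
    using finite_agents by (intro sets.finite_UN)
  moreover have "flip_event S (Suc n) = (\<Union>j\<in>agents S. {\<omega> \<in> space (law S). chosen S (Suc n) \<omega> = j} \<inter>
      {\<omega> \<in> space (law S). spin1 S j (epoch S (Suc n) \<omega>) \<omega> \<noteq> spin1 S j (epoch S n \<omega>) \<omega>})"
    using chosen_agent[of _ n] by (auto simp: flip_event_def)
  ultimately show ?thesis by simp
qed

lemma choice_flip_sets:
  assumes "j \<in> agents S"
  shows "choice_flip S n j \<in> sets (law S)"
proof -
  have "choice_flip S n j = flip_event S (Suc n) \<inter> {\<omega> \<in> space (law S). chosen S (Suc n) \<omega> = j}"
    by (auto simp: choice_flip_def flip_event_def)
  then show ?thesis using flip_event_sets choice_event_sets[OF choice_event[OF assms]] by auto
qed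

lemma prob_chosen:
  assumes "j \<in> agents S"
  shows "prob {\<omega> \<in> space (law S). chosen S (Suc n) \<omega> = j} = 1 / real N"
proof -
  have "measure (distr (law S) (count_space (agents S)) (chosen S (Suc n))) {j} = 1 / real N"
    unfolding chosen_uniform using assms finite_agents card_agents
    by (subst measure_uniform_count_measure) auto
  then show ?thesis
    using assms by (subst (asm) measure_distr[OF chosen_rv]) (auto simp: vimage_def Int_def conj_commute)
qed

text \<open>Independence of the choice from the past turns its conditional law into the uniform one.\<close>

lemma cond_exp_chosen:
  assumes j: "j \<in> agents S"
  shows "AE \<omega> in law S. real_cond_exp (law S) (history S n)
    (indicator {\<omega> \<in> space (law S). chosen S (Suc n) \<omega> = j}) \<omega> = 1 / real N"
proof -
  interpret F: sigma_finite_subalgebra "law S" "history S n" by (rule sfs_history)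
  let ?J = "{\<omega> \<in> space (law S). chosen S (Suc n) \<omega> = j}"
  have J: "?J \<in> sets (law S)" by (rule choice_event_sets[OF choice_event[OF j]])
  show ?thesis
  proof (rule F.real_cond_exp_charact)
    fix A assume A: "A \<in> sets (history S n)"
    then have A': "A \<in> sets (law S)" using subalgebra_history by (auto simp: subalgebra_def)
    have "(LINT x:A|law S. indicator ?J x) = prob (A \<inter> ?J)"
      unfolding set_lebesgue_integral_def using A' J
      by (simp add: indicator_inter_arith[symmetric] Int_absorb1 sets.sets_into_space)
    also have "\<dots> = prob A * (1 / real N)"
      using indep_setD[OF chosen_indep A choice_event[OF j]] prob_chosen[OF j] by simp
    also have "\<dots> = (LINT x:A|law S. 1 / real N)"
      using A' by (simp add: set_lebesgue_integral_def)
    finally show "(LINT x:A|law S. indicator ?J x) = (LINT x:A|law S. 1 / real N)" .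
  qed (use J in \<open>auto intro!: integrable_real_indicator simp: emeasure_eq_measure\<close>)
qed

text \<open>
  Conditioning first on the history together with the choice gives the flip probability of the
  chosen agent. On the event that \<open>j\<close> is chosen, this equals the flip probability of site \<open>j\<close>,
  which is known from the history alone; taking it out leaves the probability of choosing \<open>j\<close>.
\<close>

lemma cond_exp_choice_flip:
  assumes j: "j \<in> agents S"
  shows "AE \<omega> in law S. real_cond_exp (law S) (history S n) (indicator (choice_flip S n j)) \<omega>
    = site_flip_prob d N \<alpha> q S n j \<omega> / real N"
proof -
  interpret F: sigma_finite_subalgebra "law S" "history S n" by (rule sfs_history)
  interpret G: sigma_finite_subalgebra "law S" "history_choice S n" by (rule sfs_history_choice)
  let ?J = "{\<omega> \<in> space (law S). chosen S (Suc n) \<omega> = j}" and ?w = "site_flip_prob d N \<alpha> q S n j"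
  let ?A = "choice_flip S n j" and ?F = "history S n" and ?G = "history_choice S n"
  have J: "?J \<in> sets (law S)" by (rule choice_event_sets[OF choice_event[OF j]])
  have JG: "indicator ?J \<in> borel_measurable ?G"
    by (intro borel_measurable_indicator choice_event_in_history_choice choice_event j)
  have A: "?A \<in> sets (law S)" by (rule choice_flip_sets[OF j])
  have int: "integrable (law S) (indicator B :: _ \<Rightarrow> real)" if "B \<in> sets (law S)" for B
    using that by (intro integrable_real_indicator) (auto simp: emeasure_eq_measure)
  have w: "?w \<in> borel_measurable ?F" by (rule site_flip_prob_history[OF j])
  have wM: "?w \<in> borel_measurable (law S)" by (rule measurable_from_subalg[OF subalgebra_history w])
  have A_eq: "(indicator ?A :: _ \<Rightarrow> real) = (\<lambda>\<omega>. indicator ?J \<omega> * indicator (flip_event S (Suc n)) \<omega>)"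
    by (auto simp: fun_eq_iff choice_flip_def flip_event_def indicator_def)
  have "AE \<omega> in law S. real_cond_exp (law S) ?G (indicator ?A) \<omega>
      = indicator ?J \<omega> * real_cond_exp (law S) ?G (indicator (flip_event S (Suc n))) \<omega>"
    unfolding A_eq
    by (rule G.real_cond_exp_mult[OF JG])
      (use flip_event_sets int[OF A] in \<open>auto simp: A_eq\<close>)
  with spin1_flip[of n]
  have inner: "AE \<omega> in law S. real_cond_exp (law S) ?G (indicator ?A) \<omega> = ?w \<omega> * indicator ?J \<omega>"
    by eventually_elim (auto simp: indicator_def flip_prob_def site_flip_prob_def)
  have "integrable (law S) (real_cond_exp (law S) ?G (indicator ?A))"
    by (rule G.real_cond_exp_int(1)[OF int[OF A]])
  \<comment> \<open>No bound on the flip probability is known off the chosen site; on it, the product agrees almost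
    surely with a conditional expectation.\<close>
  then have int_wJ: "integrable (law S) (\<lambda>\<omega>. ?w \<omega> * indicator ?J \<omega>)"
    by (rule integrable_cong_AE_imp) (use inner wM J in auto)
  have "AE \<omega> in law S. real_cond_exp (law S) ?F (real_cond_exp (law S) ?G (indicator ?A)) \<omega>
      = real_cond_exp (law S) ?F (indicator ?A) \<omega>"
    by (rule F.real_cond_exp_nested_subalg[OF subalgebra_history_choice subalgebra_history_in_choice int[OF A]])
  moreover have "AE \<omega> in law S. real_cond_exp (law S) ?F (real_cond_exp (law S) ?G (indicator ?A)) \<omega>
      = real_cond_exp (law S) ?F (\<lambda>\<omega>. ?w \<omega> * indicator ?J \<omega>) \<omega>"
    by (rule F.real_cond_exp_cong[OF inner]) (use wM J in auto)
  moreover have "AE \<omega> in law S. real_cond_exp (law S) ?F (\<lambda>\<omega>. ?w \<omega> * indicator ?J \<omega>) \<omega>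
      = ?w \<omega> * real_cond_exp (law S) ?F (indicator ?J) \<omega>"
    by (rule F.real_cond_exp_mult[OF w _ int_wJ]) (use J in auto)
  ultimately show ?thesis using cond_exp_chosen[OF j, of n] by eventually_elim simp
qed

text \<open>
  The flip probabilities of the agents are nonnegative because, by the previous lemma, they are
  positive multiples of a conditional probability. No estimate of the hypergeometric sums enters.
\<close>

lemma site_flip_prob_nonneg:
  assumes j: "j \<in> agents S"
  shows "AE \<omega> in law S. 0 \<le> site_flip_prob d N \<alpha> q S n j \<omega>"
proof -
  interpret F: sigma_finite_subalgebra "law S" "history S n" by (rule sfs_history)
  have "AE \<omega> in law S. 0 \<le> real_cond_exp (law S) (history S n) (indicator (choice_flip S n j)) \<omega>"
    by (rule F.real_cond_exp_pos) (use choice_flip_sets[OF j] in auto)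
  with cond_exp_choice_flip[OF j, of n] show ?thesis
    by eventually_elim (use N_pos in \<open>simp add: zero_le_divide_iff\<close>)
qed

text \<open>
  A pair \<open>(y, j)\<close> in \<open>I\<close> stands for the effect of a flip of \<open>j\<close> on the wealth of \<open>y\<close>. Summing over
  a set of pairs treats a single agent and the whole market at once: apart from the price,
  everything is bounded, so the conditional expectation is additive, and the price is taken out
  last.
\<close>

lemma cond_exp_wealth_gain:
  assumes I: "I \<subseteq> agents S \<times> agents S"
    and X: "\<And>\<omega>. \<omega> \<in> space (law S) \<Longrightarrow> X \<omega> = price S (epoch S n \<omega>) \<omega>
      * (\<Sum>(y, j)\<in>I. spin1 S y (epoch S n \<omega>) \<omega> * price_response N f S n j \<omega> * indicator (choice_flip S n j) \<omega>)"
  shows "AE \<omega> in law S. real_cond_exp (law S) (history S n) X \<omega>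
    = price S (epoch S n \<omega>) \<omega> / real N * (\<Sum>(y, j)\<in>I. spin1 S y (epoch S n \<omega>) \<omega>
          * (price_response N f S n j \<omega> * site_flip_prob d N \<alpha> q S n j \<omega>))"
proof -
  interpret F: sigma_finite_subalgebra "law S" "history S n" by (rule sfs_history)
  define c where "c p \<omega> = (case p of (y, j) \<Rightarrow> spin1 S y (epoch S n \<omega>) \<omega> * price_response N f S n j \<omega>)" for p \<omega>
  define R where "R p \<omega> = (if p \<in> I then c p \<omega> * indicator (choice_flip S n (snd p)) \<omega> else 0)" for p \<omega>
  have finI: "finite I" using I finite_agents by (meson finite_SigmaI finite_subset)
  have c: "c p \<in> borel_measurable (history S n)" if "p \<in> I" for p
    using that I spin1_history price_response_history
    unfolding c_def[abs_def] by (cases p) (auto intro!: borel_measurable_times)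
  have cM: "c p \<in> borel_measurable (law S)" if "p \<in> I" for p
    by (rule measurable_from_subalg[OF subalgebra_history c[OF that]])
  have A: "choice_flip S n (snd p) \<in> sets (law S)" if "p \<in> I" for p
    using that I by (intro choice_flip_sets) auto
  have bound: "\<bar>c p \<omega>\<bar> \<le> \<bar>f 1 N\<bar> + \<bar>f (- 1) N\<bar>" if "p \<in> I" "\<omega> \<in> space (law S)" for p \<omega>
  proof -
    obtain y j where p: "p = (y, j)" by (cases p)
    then have "spin1 S y (epoch S n \<omega>) \<omega> \<in> {- 1, 1}" using that I by (intro spin1_values) auto
    then show ?thesis unfolding c_def p price_response_def by auto
  qed
  have int1: "integrable (law S) (\<lambda>\<omega>. c p \<omega> * indicator (choice_flip S n (snd p)) \<omega>)" if "p \<in> I" for p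
  proof (rule integrable_const_bound[where B = "\<bar>f 1 N\<bar> + \<bar>f (- 1) N\<bar>"])
    show "AE \<omega> in law S. norm (c p \<omega> * indicator (choice_flip S n (snd p)) \<omega>) \<le> \<bar>f 1 N\<bar> + \<bar>f (- 1) N\<bar>"
      using bound[OF that] by (intro AE_I2) (auto simp: indicator_def)
  qed (use cM[OF that] A[OF that] in auto)
  have int: "integrable (law S) (R p)" for p
    using int1[of p] unfolding R_def[abs_def] by (cases "p \<in> I") auto
  have term1: "AE \<omega> in law S. real_cond_exp (law S) (history S n) (R p) \<omega>
      = c p \<omega> * (site_flip_prob d N \<alpha> q S n (snd p) \<omega> / real N)" if p: "p \<in> I" for p
  proof -
    have "AE \<omega> in law S. real_cond_exp (law S) (history S n)
        (\<lambda>\<omega>. c p \<omega> * indicator (choice_flip S n (snd p)) \<omega>) \<omega>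
        = c p \<omega> * real_cond_exp (law S) (history S n) (indicator (choice_flip S n (snd p))) \<omega>"
      by (rule F.real_cond_exp_mult) (use c[OF p] A[OF p] int1[OF p] in auto)
    moreover have "AE \<omega> in law S. real_cond_exp (law S) (history S n)
        (indicator (choice_flip S n (snd p))) \<omega> = site_flip_prob d N \<alpha> q S n (snd p) \<omega> / real N"
      by (rule cond_exp_choice_flip) (use p I in auto)
    moreover have "R p = (\<lambda>\<omega>. c p \<omega> * indicator (choice_flip S n (snd p)) \<omega>)"
      using p by (simp add: R_def[abs_def])
    ultimately show ?thesis by (auto elim: eventually_elim2)
  qed
  have "AE \<omega> in law S. \<forall>p\<in>I. real_cond_exp (law S) (history S n) (R p) \<omega>
      = c p \<omega> * (site_flip_prob d N \<alpha> q S n (snd p) \<omega> / real N)"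
    using term1 by (intro AE_finite_allI finI)
  moreover have "AE \<omega> in law S. real_cond_exp (law S) (history S n) (\<lambda>\<omega>. \<Sum>p\<in>I. R p \<omega>) \<omega>
      = (\<Sum>p\<in>I. real_cond_exp (law S) (history S n) (R p) \<omega>)"
    by (rule F.real_cond_exp_sum[OF int])
  moreover have "AE \<omega> in law S. real_cond_exp (law S) (history S n)
        (\<lambda>\<omega>. price S (epoch S n \<omega>) \<omega> * (\<Sum>p\<in>I. R p \<omega>)) \<omega>
      = price S (epoch S n \<omega>) \<omega> * real_cond_exp (law S) (history S n) (\<lambda>\<omega>. \<Sum>p\<in>I. R p \<omega>) \<omega>"
    by (rule F.real_cond_exp_mult_nonneg[OF price_history])
      (use int price_pos[THEN less_imp_le] in \<open>auto intro!: borel_measurable_sum\<close>)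
  ultimately have main: "AE \<omega> in law S. real_cond_exp (law S) (history S n)
        (\<lambda>\<omega>. price S (epoch S n \<omega>) \<omega> * (\<Sum>p\<in>I. R p \<omega>)) \<omega>
      = price S (epoch S n \<omega>) \<omega> * (\<Sum>p\<in>I. c p \<omega> * (site_flip_prob d N \<alpha> q S n (snd p) \<omega> / real N))"
    by eventually_elim simp
  have R_sum: "X \<omega> = price S (epoch S n \<omega>) \<omega> * (\<Sum>p\<in>I. R p \<omega>)" if "\<omega> \<in> space (law S)" for \<omega>
    unfolding X[OF that] by (intro arg_cong2[where f = "(*)"] sum.cong) (auto simp: R_def c_def)
  have meas: "(\<lambda>\<omega>. price S (epoch S n \<omega>) \<omega> * (\<Sum>p\<in>I. R p \<omega>)) \<in> borel_measurable (law S)"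
    using price_rv int by (auto intro!: borel_measurable_sum borel_measurable_times)
  moreover from this have "X \<in> borel_measurable (law S)"
    by (rule measurable_cong[THEN iffD2, rotated]) (rule R_sum)
  ultimately have X_cong: "AE \<omega> in law S. real_cond_exp (law S) (history S n) X \<omega>
      = real_cond_exp (law S) (history S n) (\<lambda>\<omega>. price S (epoch S n \<omega>) \<omega> * (\<Sum>p\<in>I. R p \<omega>)) \<omega>"
    by (intro F.real_cond_exp_cong AE_I2 R_sum)
  have c_sum: "price S (epoch S n \<omega>) \<omega> * (\<Sum>p\<in>I. c p \<omega> * (site_flip_prob d N \<alpha> q S n (snd p) \<omega> / real N))
      = price S (epoch S n \<omega>) \<omega> / real N * (\<Sum>(y, j)\<in>I. spin1 S y (epoch S n \<omega>) \<omega>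
          * (price_response N f S n j \<omega> * site_flip_prob d N \<alpha> q S n j \<omega>))" for \<omega>
    unfolding sum_distrib_left by (intro sum.cong) (auto simp: c_def)
  from X_cong main show ?thesis unfolding c_sum by eventually_elim simp
qed

text \<open>
  At most the chosen agent flips, so the net flip is half the change of its first spin.
\<close>

lemma impact_net_flip:
  assumes \<omega>: "\<omega> \<in> space (law S)"
  shows "f (net_flip S (Suc n) \<omega>) N =
    (if \<omega> \<in> flip_event S (Suc n) then price_response N f S n (chosen S (Suc n) \<omega>) \<omega> else 0)"
proof -
  let ?Y = "agents S" and ?j = "chosen S (Suc n) \<omega>"
  have count: "real (n_plus S (epoch S m \<omega>) \<omega>) = (\<Sum>y\<in>?Y. (spin1 S y (epoch S m \<omega>) \<omega> + 1) / 2)" for m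
  proof -
    have "real (n_plus S (epoch S m \<omega>) \<omega>) = (\<Sum>y\<in>?Y. if spin1 S y (epoch S m \<omega>) \<omega> = 1 then 1 else 0)"
      unfolding n_plus_def using finite_agents by (simp add: sum.If_cases Int_def)
    also have "\<dots> = (\<Sum>y\<in>?Y. (spin1 S y (epoch S m \<omega>) \<omega> + 1) / 2)"
    proof (intro sum.cong refl)
      fix y assume "y \<in> ?Y"
      then show "(if spin1 S y (epoch S m \<omega>) \<omega> = 1 then 1 else 0) = (spin1 S y (epoch S m \<omega>) \<omega> + 1) / 2"
        using spin1_values[OF _ \<omega>, of y m] by auto
    qed
    finally show ?thesis .
  qed
  have j: "?j \<in> ?Y" by (rule chosen_agent[OF \<omega>])
  have "(\<Sum>y\<in>?Y - {?j}. (spin1 S y (epoch S (Suc n) \<omega>) \<omega> + 1) / 2) = (\<Sum>y\<in>?Y - {?j}. (spin1 S y (epoch S n \<omega>) \<omega> + 1) / 2)"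
    by (intro sum.cong) (use spin1_others[OF _ \<omega>] in auto)
  then have net: "net_flip S (Suc n) \<omega> = (spin1 S ?j (epoch S (Suc n) \<omega>) \<omega> - spin1 S ?j (epoch S n \<omega>) \<omega>) / 2"
    unfolding net_flip_def count by (simp add: sum.remove[OF finite_agents j] field_simps)
  show ?thesis
    using spin1_values[OF j \<omega>, of n] spin1_values[OF j \<omega>, of "Suc n"] impact_0 \<omega>
    by (auto simp: net flip_event_def price_response_def)
qed

text \<open>
  An agent gains from the flips of the others only, as the chosen agent does not trade. On each
  path at most one summand is nonzero.
\<close>

lemma wealth_increment:
  assumes y: "y \<in> agents S" and \<omega>: "\<omega> \<in> space (law S)"
  shows "wealth S y (epoch S (Suc n) \<omega>) \<omega> - wealth S y (epoch S n \<omega>) \<omega>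
    = price S (epoch S n \<omega>) \<omega> * (\<Sum>j\<in>agents S - {y}. spin1 S y (epoch S n \<omega>) \<omega>
          * price_response N f S n j \<omega> * indicator (choice_flip S n j) \<omega>)"
proof -
  let ?j = "chosen S (Suc n) \<omega>"
  let ?r = "spin1 S y (epoch S n \<omega>) \<omega> * price_response N f S n ?j \<omega> * indicator (flip_event S (Suc n)) \<omega>"
  have j: "?j \<in> agents S" by (rule chosen_agent[OF \<omega>])
  have "(\<Sum>j\<in>agents S - {y}. spin1 S y (epoch S n \<omega>) \<omega>
          * price_response N f S n j \<omega> * indicator (choice_flip S n j) \<omega>)
      = (\<Sum>j\<in>agents S - {y}. if j = ?j then ?r else 0)"
    by (intro sum.cong) (auto simp: choice_flip_def indicator_def)
  also have "\<dots> = (if ?j = y then 0 else ?r)"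
    using j finite_agents by simp
  finally show ?thesis
    using wealth_step[OF y \<omega>, of n] price_step[OF \<omega>, of n] impact_net_flip[OF \<omega>, of n]
    by (auto simp: indicator_def)
qed

definition expected_gain :: "nat \<Rightarrow> 'a \<Rightarrow> 'w \<Rightarrow> real" where
  "expected_gain n y \<omega> = price S (epoch S n \<omega>) \<omega> / real N * (spin1 S y (epoch S n \<omega>) \<omega>
          * (\<Sum>j\<in>agents S - {y}. price_response N f S n j \<omega> * site_flip_prob d N \<alpha> q S n j \<omega>))"

text \<open>
  Each other agent is chosen with probability one over \<open>N\<close> and then flips with its own flip
  probability; only these flips move the wealth of \<open>y\<close>.
\<close>

lemma agent_drift:
  assumes y: "y \<in> agents S"
  shows "AE \<omega> in law S. real_cond_exp (law S) (history S n)
      (\<lambda>\<omega>. wealth S y (epoch S (Suc n) \<omega>) \<omega> - wealth S y (epoch S n \<omega>) \<omega>) \<omega>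
    = expected_gain n y \<omega>"
proof -
  have pairs: "(\<Sum>(y', j)\<in>{y} \<times> (agents S - {y}). h y' j) = (\<Sum>j\<in>agents S - {y}. h y j)" for h :: "'a \<Rightarrow> 'a \<Rightarrow> real"
    using finite_agents by (subst sum.cartesian_product[symmetric]) simp
  show ?thesis
    using cond_exp_wealth_gain[where I = "{y} \<times> (agents S - {y})" and n = n and
        X = "\<lambda>\<omega>. wealth S y (epoch S (Suc n) \<omega>) \<omega> - wealth S y (epoch S n \<omega>) \<omega>"] y
    by (auto simp: expected_gain_def pairs wealth_increment sum_distrib_left mult.assoc)
qed

lemma market_drift_expected_gain:
  "AE \<omega> in law S. market_drift S (Suc n) \<omega> = (\<Sum>y\<in>agents S. expected_gain n y \<omega>)"
proof -
  have pairs: "(\<Sum>(y, j)\<in>Sigma (agents S) (\<lambda>y. agents S - {y}). h y j)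
      = (\<Sum>y\<in>agents S. \<Sum>j\<in>agents S - {y}. h y j)" for h :: "'a \<Rightarrow> 'a \<Rightarrow> real"
    using finite_agents by (subst sum.Sigma[symmetric]) auto
  have "market_wealth S (epoch S (Suc n) \<omega>) \<omega> - market_wealth S (epoch S n \<omega>) \<omega>
      = price S (epoch S n \<omega>) \<omega> * (\<Sum>y\<in>agents S. \<Sum>j\<in>agents S - {y}. spin1 S y (epoch S n \<omega>) \<omega>
          * price_response N f S n j \<omega> * indicator (choice_flip S n j) \<omega>)" if "\<omega> \<in> space (law S)" for \<omega>
    unfolding market_wealth_def sum_subtractf[symmetric]
    by (subst sum_distrib_left, intro sum.cong refl wealth_increment that)
  then show ?thesis
    using cond_exp_wealth_gain[where I = "Sigma (agents S) (\<lambda>y. agents S - {y})" and n = n and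
        X = "\<lambda>\<omega>. market_wealth S (epoch S (Suc n) \<omega>) \<omega> - market_wealth S (epoch S n \<omega>) \<omega>"]
    unfolding pairs market_drift_def by (simp add: expected_gain_def sum_distrib_left mult.assoc subset_iff)
qed

lemma majority_opinion_expected_gain:
  "AE \<omega> in law S. majority_opinion S (Suc n) \<omega> = (\<Sum>y\<in>agents S. sgn (expected_gain n y \<omega>))"
proof -
  have "AE \<omega> in law S. \<forall>y\<in>agents S. real_cond_exp (law S) (history S n)
      (\<lambda>\<omega>. wealth S y (epoch S (Suc n) \<omega>) \<omega> - wealth S y (epoch S n \<omega>) \<omega>) \<omega> = expected_gain n y \<omega>"
    using agent_drift by (intro AE_finite_allI finite_agents)
  then show ?thesis
    unfolding majority_opinion_def by eventually_elim simp
qed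

end


section \<open>The majority follows a falling market\<close>

text \<open>
  Here \<open>p\<close> agents expect \<open>A\<close> and \<open>m\<close> agents expect \<open>B\<close>. If only one
  group is present, total and sum of signs have the same sign. Otherwise the expectation of larger
  absolute value is nonnegative, since \<open>A + B \<ge> 0\<close>. Were the sum of signs positive, then either nobody
  expects to lose, or those who expect to gain are both in the majority and gain at least as much
  each as the others lose; in both cases the total is positive.
\<close>

lemma weighted_sgn_nonpos:
  fixes A B p m :: real
  assumes p: "0 \<le> p" and m: "0 \<le> m" and AB: "0 < p \<Longrightarrow> 0 < m \<Longrightarrow> 0 \<le> A + B"
    and D: "p * A + m * B \<le> 0"
  shows "p * sgn A + m * sgn B \<le> 0"
proof (cases "0 < p \<and> 0 < m")
  case False
  then have "p = 0 \<or> m = 0" using p m by auto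
  then show ?thesis
    using D p m by (auto simp: mult_le_0_iff sgn_if split: if_splits)
next
  case True
  then have pos: "0 < p" "0 < m" by auto
  consider "A \<le> 0" "B \<le> 0" | "0 < A" "0 \<le> B" | "0 \<le> A" "0 < B" | "0 < A" "B < 0" | "A < 0" "0 < B"
    by linarith
  then show ?thesis
  proof cases
    case 1
    then show ?thesis using p m by (auto simp: sgn_if)
  next
    case 2
    then have "0 < p * A + m * B" using pos by (intro add_pos_nonneg) auto
    then show ?thesis using D by simp
  next
    case 3
    then have "0 < p * A + m * B" using pos by (intro add_nonneg_pos) auto
    then show ?thesis using D by simp
  next
    case 4
    \<comment> \<open>The loss \<open>- B\<close> is at most \<open>A\<close>, so losers cannot outweigh equally many winners.\<close>
    have "(p - m) * A \<le> p * A + m * B"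
      using mult_left_mono[of 0 "A + B" m] AB[OF pos] m by (simp add: algebra_simps)
    then have "p \<le> m" using D \<open>0 < A\<close> by (meson diff_gt_0_iff_gt mult_pos_pos not_le order_trans)
    then show ?thesis using 4 by simp
  next
    case 5
    have "(m - p) * B \<le> p * A + m * B"
      using mult_left_mono[of 0 "A + B" p] AB[OF pos] p by (simp add: algebra_simps)
    then have "m \<le> p" using D \<open>0 < B\<close> by (meson diff_gt_0_iff_gt mult_pos_pos not_le order_trans)
    then show ?thesis using 5 by simp
  qed
qed

context frozen_market
begin

lemma impact_minus_1: "f (- 1) N \<le> 0"
  using monoD[OF impact_mono, of "- 1" 0] impact_0 by simp

text \<open>
  If everybody, including the agent itself, could trade on the flip of every agent, a buyer and a
  seller would expect exactly opposite gains, \<open>P * G\<close> and \<open>- P * G\<close>. What breaks the symmetry is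
  that nobody trades on its own flip: a buyer is spared the fall of the price that its own flip
  would cause, and a seller the rise. Both corrections are in the agent's favour, so the
  expectations \<open>A\<close> of a buyer and \<open>B\<close> of a seller have a nonnegative sum. Buyers among themselves,
  and sellers among themselves, expect the same.
\<close>

lemma majority_follows_market:
  assumes \<omega>: "\<omega> \<in> space (law S)"
    and nonneg: "\<And>j. j \<in> agents S \<Longrightarrow> 0 \<le> site_flip_prob d N \<alpha> q S n j \<omega>"
    and market: "(\<Sum>y\<in>agents S. expected_gain n y \<omega>) \<le> 0"
  shows "(\<Sum>y\<in>agents S. sgn (expected_gain n y \<omega>)) \<le> 0"
proof -
  define plus where "plus = {y \<in> agents S. spin1 S y (epoch S n \<omega>) \<omega> = 1}"
  define minus where "minus = agents S - plus"
  define u v where "u = flip_up_prob d N \<alpha> q (n_plus S (epoch S n \<omega>) \<omega>) (consulted_spin2 S (Suc n) \<omega>)"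
    and "v = flip_down_prob d N \<alpha> q (n_plus S (epoch S n \<omega>) \<omega>) (consulted_spin2 S (Suc n) \<omega>)"
  define G where "G = (\<Sum>j\<in>agents S. price_response N f S n j \<omega> * site_flip_prob d N \<alpha> q S n j \<omega>)"
  define P where "P = price S (epoch S n \<omega>) \<omega> / real N"
  define A B where "A = P * (G - f (- 1) N * v)" and "B = - (P * (G - f 1 N * u))"
  have P: "0 \<le> P" using price_pos[OF \<omega>, of n] unfolding P_def by simp
  have spin_plus: "spin1 S y (epoch S n \<omega>) \<omega> = 1" if "y \<in> plus" for y
    using that by (simp add: plus_def)
  have spin_minus: "spin1 S y (epoch S n \<omega>) \<omega> = - 1" if "y \<in> minus" for y
    using that spin1_values[OF _ \<omega>, of y n] by (auto simp: plus_def minus_def)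
  have remove: "(\<Sum>j\<in>agents S - {y}. price_response N f S n j \<omega> * site_flip_prob d N \<alpha> q S n j \<omega>)
      = G - price_response N f S n y \<omega> * site_flip_prob d N \<alpha> q S n y \<omega>" if "y \<in> agents S" for y
    unfolding G_def by (simp add: sum.remove[OF finite_agents that])
  have gain_plus: "expected_gain n y \<omega> = A" if "y \<in> plus" for y
    using that spin_plus[OF that] remove[of y]
    by (simp add: expected_gain_def A_def P_def price_response_def site_flip_prob_def v_def plus_def Let_def)
  have gain_minus: "expected_gain n y \<omega> = B" if "y \<in> minus" for y
  proof -
    have "expected_gain n y \<omega> = P * (- 1 * (G - f 1 N * u))"
      unfolding expected_gain_def P_def using that spin_minus[OF that]
      by (subst remove) (auto simp: price_response_def site_flip_prob_def u_def minus_def Let_def)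
    then show ?thesis by (simp add: B_def algebra_simps)
  qed
  have v0: "0 \<le> v" if "y \<in> plus" for y
    using nonneg[of y] that spin_plus[OF that] by (simp add: site_flip_prob_def v_def plus_def Let_def)
  have u0: "0 \<le> u" if "y \<in> minus" for y
    using nonneg[of y] that spin_minus[OF that] by (simp add: site_flip_prob_def u_def minus_def Let_def)
  have split: "(\<Sum>y\<in>agents S. h y) = (\<Sum>y\<in>plus. h y) + (\<Sum>y\<in>minus. h y)" for h :: "'a \<Rightarrow> real"
    unfolding minus_def using finite_agents by (subst sum.subset_diff[of plus]) (auto simp: plus_def)
  have "real (card plus) * sgn A + real (card minus) * sgn B \<le> 0"
  proof (rule weighted_sgn_nonpos)
    show "real (card plus) * A + real (card minus) * B \<le> 0"
      using market unfolding split by (simp add: gain_plus gain_minus)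
    assume "0 < real (card plus)" "0 < real (card minus)"
    then have "plus \<noteq> {}" "minus \<noteq> {}" by auto
    then have "0 \<le> u" "0 \<le> v" using u0 v0 by auto
    then have "0 \<le> f 1 N * u" "0 \<le> - f (- 1) N * v"
      using impact_1 impact_minus_1 by (auto intro: mult_nonneg_nonneg simp: mult_nonpos_nonneg)
    then have "0 \<le> P * (f 1 N * u - f (- 1) N * v)" using P by simp
    then show "0 \<le> A + B" unfolding A_def B_def by (simp add: algebra_simps)
  qed auto
  then show ?thesis unfolding split by (simp add: gain_plus gain_minus)
qed

lemma supermartingale_majority:
  assumes "1 \<le> k"
  shows "AE \<omega> in law S. market_drift S k \<omega> \<le> 0 \<longrightarrow> majority_opinion S k \<omega> \<le> 0"
proof -
  obtain n where k: "k = Suc n" using assms by (cases k) auto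
  have "AE \<omega> in law S. \<forall>j\<in>agents S. 0 \<le> site_flip_prob d N \<alpha> q S n j \<omega>"
    using site_flip_prob_nonneg by (intro AE_finite_allI finite_agents)
  with market_drift_expected_gain[of n] majority_opinion_expected_gain[of n] AE_space
  show ?thesis
    unfolding k by eventually_elim (auto intro: majority_follows_market)
qed

end

section \<open>A market that disagrees with its majority\<close>

lemma distr_pair_snd:
  assumes "prob_space M" "sigma_finite_measure N"
  shows "distr (M \<Otimes>\<^sub>M N) N snd = N"
proof (rule measure_eqI)
  interpret M: prob_space M by fact
  interpret N: sigma_finite_measure N by fact
  fix A assume "A \<in> sets (distr (M \<Otimes>\<^sub>M N) N snd)"
  then have A: "A \<in> sets N" by simp
  then have "snd -` A \<inter> space (M \<Otimes>\<^sub>M N) = space M \<times> A"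
    using sets.sets_into_space by (fastforce simp: space_pair_measure)
  then show "emeasure (distr (M \<Otimes>\<^sub>M N) N snd) A = emeasure N A"
    using A by (simp add: emeasure_distr N.emeasure_pair_measure_Times M.emeasure_space_1)
qed simp

definition waiting_time_law :: "real measure" where
  "waiting_time_law = density lborel (exponential_density 1)"

text \<open>
  Each epoch is driven by an independent mark: the chosen agent, the waiting time, and a second
  real number that pads the mark to a triple.
\<close>

definition mark_law :: "(nat \<times> real \<times> real) measure" where
  "mark_law = uniform_count_measure {0, 1, 2} \<Otimes>\<^sub>M (waiting_time_law \<Otimes>\<^sub>M waiting_time_law)"

definition path_law :: "(nat \<Rightarrow> nat \<times> real \<times> real) measure" where
  "path_law = (\<Pi>\<^sub>M n\<in>UNIV. mark_law)"

definition selected :: "nat \<Rightarrow> (nat \<Rightarrow> nat \<times> real \<times> real) \<Rightarrow> nat" where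
  "selected n \<omega> = fst (\<omega> n)"

text \<open>Epochs have to increase on every path, so the null event of a nonpositive waiting time is replaced.\<close>

definition gap :: "nat \<Rightarrow> (nat \<Rightarrow> nat \<times> real \<times> real) \<Rightarrow> real" where
  "gap n \<omega> = (if 0 < fst (snd (\<omega> n)) then fst (snd (\<omega> n)) else 1)"

definition jump_time :: "nat \<Rightarrow> (nat \<Rightarrow> nat \<times> real \<times> real) \<Rightarrow> real" where
  "jump_time n \<omega> = (\<Sum>m<n. gap m \<omega>)"

definition start_spin :: "nat \<Rightarrow> real" where
  "start_spin y = (if y = 2 then - 1 else 1)"

definition jump_spin1 :: "nat \<Rightarrow> nat \<Rightarrow> (nat \<Rightarrow> nat \<times> real \<times> real) \<Rightarrow> real" where
  "jump_spin1 y n \<omega> = start_spin y * (\<Prod>m<n. if selected m \<omega> = y then - 1 else 1)"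

text \<open>
  A price that falls by more than it rises is what makes the two buyers pessimistic in a state with
  two buyers and one seller; being bounded below by \<open>- 1 / 2\<close>, it keeps the price positive.
\<close>

definition step_impact :: "real \<Rightarrow> nat \<Rightarrow> real" where
  "step_impact x M = (if x < 0 then - 1 / 2 else if x = 0 then 0 else 1 / 4)"

primrec jump_spin2 :: "nat \<Rightarrow> nat \<Rightarrow> real" where
  "jump_spin2 y 0 = 1"
| "jump_spin2 y (Suc n) = next_spin2 1 3 7 1 step_impact (Suc y) (jump_spin2 y n)"

definition jump_plus :: "nat \<Rightarrow> (nat \<Rightarrow> nat \<times> real \<times> real) \<Rightarrow> nat" where
  "jump_plus n \<omega> = card {y \<in> {0, 1, 2}. jump_spin1 y n \<omega> = 1}"

primrec jump_price :: "nat \<Rightarrow> (nat \<Rightarrow> nat \<times> real \<times> real) \<Rightarrow> real" where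
  "jump_price 0 \<omega> = 1"
| "jump_price (Suc n) \<omega> =
     jump_price n \<omega> * (1 + step_impact (real (jump_plus (Suc n) \<omega>) - real (jump_plus n \<omega>)) 3)"

primrec jump_wealth :: "nat \<Rightarrow> nat \<Rightarrow> (nat \<Rightarrow> nat \<times> real \<times> real) \<Rightarrow> real" where
  "jump_wealth y 0 \<omega> = 0"
| "jump_wealth y (Suc n) \<omega> = (if selected n \<omega> = y then jump_wealth y n \<omega>
     else jump_wealth y n \<omega> + jump_spin1 y n \<omega> * (jump_price (Suc n) \<omega> - jump_price n \<omega>))"

definition jump_index :: "real \<Rightarrow> (nat \<Rightarrow> nat \<times> real \<times> real) \<Rightarrow> nat" where
  "jump_index t \<omega> = (LEAST n. t < jump_time (Suc n) \<omega>)"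

text \<open>
  With the choice \<open>\<alpha> = 7\<close> for three agents and \<open>d = 1\<close>, no number of buyers lies in the range where
  an agent may stay, so with \<open>q = 1\<close> the chosen agent always flips. All variables are thereby
  explicit functions of the marks.
\<close>

definition contrarian_market :: "(nat \<Rightarrow> nat \<times> real \<times> real, nat) spin_market" where
  "contrarian_market = \<lparr>law = path_law, agents = {0, 1, 2}, label = Suc, epoch = jump_time,
     chosen = (\<lambda>n. selected (n - 1)),
     spin1 = (\<lambda>y t \<omega>. jump_spin1 y (jump_index t \<omega>) \<omega>),
     spin2 = (\<lambda>y t \<omega>. jump_spin2 y (jump_index t \<omega>)),
     price = (\<lambda>t \<omega>. jump_price (jump_index t \<omega>) \<omega>),
     wealth = (\<lambda>y t \<omega>. jump_wealth y (jump_index t \<omega>) \<omega>)\<rparr>"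

lemma contrarian_simps [simp]:
  "law contrarian_market = path_law" "agents contrarian_market = {0, 1, 2}"
  "label contrarian_market = Suc" "epoch contrarian_market = jump_time"
  "chosen contrarian_market n = selected (n - 1)"
  "spin1 contrarian_market y t \<omega> = jump_spin1 y (jump_index t \<omega>) \<omega>"
  "spin2 contrarian_market y t \<omega> = jump_spin2 y (jump_index t \<omega>)"
  "price contrarian_market t \<omega> = jump_price (jump_index t \<omega>) \<omega>"
  "wealth contrarian_market y t \<omega> = jump_wealth y (jump_index t \<omega>) \<omega>"
  by (simp_all add: contrarian_market_def)

lemma gap_pos: "0 < gap n \<omega>" by (simp add: gap_def)

lemma jump_time_Suc: "jump_time (Suc n) \<omega> = jump_time n \<omega> + gap n \<omega>"
  by (simp add: jump_time_def)

lemma strict_mono_jump_time: "strict_mono (\<lambda>n. jump_time n \<omega>)"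
  by (rule strict_monoI_Suc) (simp add: jump_time_Suc gap_pos)

lemma jump_index_eq:
  assumes "jump_time n \<omega> \<le> t" "t < jump_time (Suc n) \<omega>"
  shows "jump_index t \<omega> = n"
  unfolding jump_index_def
proof (rule Least_equality)
  show "t < jump_time (Suc n) \<omega>" by fact
  fix m assume "t < jump_time (Suc m) \<omega>"
  then have "jump_time n \<omega> < jump_time (Suc m) \<omega>" using assms(1) by simp
  then show "n \<le> m" using strict_mono_less[OF strict_mono_jump_time] by simp
qed

lemma jump_index_jump_time [simp]: "jump_index (jump_time n \<omega>) \<omega> = n"
  by (rule jump_index_eq) (simp_all add: jump_time_Suc gap_pos)

lemma piecewise_constant_contrarian:
  "piecewise_constant contrarian_market (\<lambda>t \<omega>. h (jump_index t \<omega>) \<omega>)"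
  unfolding piecewise_constant_def by (auto simp: jump_index_eq)

lemma prob_space_waiting_time: "prob_space waiting_time_law"
  unfolding waiting_time_law_def by (rule prob_space_exponential_density) simp

lemma sets_waiting_time [measurable_cong, simp]: "sets waiting_time_law = sets borel"
  by (simp add: waiting_time_law_def)

lemma prob_space_waiting_pair: "prob_space (waiting_time_law \<Otimes>\<^sub>M waiting_time_law)"
proof -
  interpret E: prob_space waiting_time_law by (rule prob_space_waiting_time)
  interpret pair_prob_space waiting_time_law waiting_time_law ..
  show ?thesis by (rule prob_space_axioms)
qed

lemma prob_space_uniform_agents: "prob_space (uniform_count_measure {0, 1, 2 :: nat})"
  by (rule prob_space_uniform_count_measure) auto

lemma prob_space_mark: "prob_space mark_law"
proof -
  interpret U: prob_space "uniform_count_measure {0, 1, 2 :: nat}" by (rule prob_space_uniform_agents)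
  interpret E: prob_space "waiting_time_law \<Otimes>\<^sub>M waiting_time_law" by (rule prob_space_waiting_pair)
  interpret pair_prob_space "uniform_count_measure {0, 1, 2 :: nat}" "waiting_time_law \<Otimes>\<^sub>M waiting_time_law" ..
  show ?thesis unfolding mark_law_def by (rule prob_space_axioms)
qed

lemma prob_space_path: "prob_space path_law"
  unfolding path_law_def by (rule prob_space_PiM) (rule prob_space_mark)

lemma space_path: "space path_law = {\<omega>. \<forall>n. \<omega> n \<in> space mark_law}"
  by (auto simp: path_law_def space_PiM PiE_def extensional_def)

lemma coordinate_measurable: "(\<lambda>\<omega>. \<omega> n) \<in> measurable path_law mark_law"
  unfolding path_law_def by (rule measurable_component_singleton) simp

lemma distr_coordinate: "distr path_law mark_law (\<lambda>\<omega>. \<omega> n) = mark_law"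
  unfolding path_law_def by (rule distr_PiM_component) (auto intro: prob_space_mark)

lemma agent_mark_measurable: "fst \<in> measurable mark_law (count_space {0, 1, 2})"
proof -
  have "sets (uniform_count_measure {0, 1, 2 :: nat}) = sets (count_space {0, 1, 2})"
    by (simp add: sets_uniform_count_measure)
  then show ?thesis
    unfolding mark_law_def by (subst measurable_cong_sets[OF refl, symmetric]) (assumption, rule measurable_fst)
qed

lemma time_mark_measurable: "(\<lambda>x. fst (snd x)) \<in> borel_measurable mark_law"
  unfolding mark_law_def by measurable

lemma distr_agent_mark: "distr mark_law (count_space {0, 1, 2}) fst = uniform_count_measure {0, 1, 2}"
proof -
  interpret E: prob_space "waiting_time_law \<Otimes>\<^sub>M waiting_time_law" by (rule prob_space_waiting_pair)
  have "distr mark_law (count_space {0, 1, 2}) fst = distr mark_law (uniform_count_measure {0, 1, 2}) fst"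
    by (rule distr_cong) (auto simp: sets_uniform_count_measure)
  then show ?thesis unfolding mark_law_def E.distr_pair_fst .
qed

lemma distr_time_mark: "distr mark_law borel (\<lambda>x. fst (snd x)) = waiting_time_law"
proof -
  let ?E = waiting_time_law
  interpret E: prob_space ?E by (rule prob_space_waiting_time)
  interpret EE: prob_space "?E \<Otimes>\<^sub>M ?E" by (rule prob_space_waiting_pair)
  have "distr mark_law borel (\<lambda>x. fst (snd x)) = distr (distr mark_law (?E \<Otimes>\<^sub>M ?E) snd) ?E fst"
  proof (subst distr_distr)
    show "distr mark_law borel (\<lambda>x. fst (snd x)) = distr mark_law ?E (fst \<circ> snd)"
      by (rule distr_cong) auto
  qed (auto simp: mark_law_def)
  then show ?thesis
    unfolding mark_law_def distr_pair_snd[OF prob_space_uniform_agents EE.sigma_finite_measure_axioms]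
    by (simp add: E.distr_pair_fst)
qed

lemma indep_coordinates: "prob_space.indep_vars path_law (\<lambda>_. mark_law) (\<lambda>n \<omega>. \<omega> n) UNIV"
proof -
  interpret prob_space path_law by (rule prob_space_path)
  have "distr path_law (\<Pi>\<^sub>M i\<in>UNIV. mark_law) (\<lambda>x. x) = path_law"
    unfolding path_law_def by (rule distr_id)
  then show ?thesis
    by (subst indep_vars_iff_distr_eq_PiM') (auto simp: distr_coordinate coordinate_measurable path_law_def[symmetric] restrict_UNIV)
qed

lemma gap_measurable: "gap n \<in> borel_measurable path_law"
proof -
  note [measurable] = measurable_compose[OF coordinate_measurable time_mark_measurable, of n]
  show ?thesis unfolding gap_def[abs_def] by measurable
qed

lemma gap_distributed: "distributed path_law lborel (gap n) (exponential_density 1)"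
proof -
  define g :: "real \<Rightarrow> real" where "g t = (if 0 < t then t else 1)" for t
  have g [measurable]: "g \<in> borel_measurable borel" unfolding g_def[abs_def] by measurable
  note [measurable] = coordinate_measurable time_mark_measurable
  have "distr path_law lborel (gap n) = distr path_law borel (\<lambda>\<omega>. g (fst (snd (\<omega> n))))"
    by (rule distr_cong) (auto simp: gap_def g_def)
  also have "\<dots> = distr (distr (distr path_law mark_law (\<lambda>\<omega>. \<omega> n)) borel (\<lambda>x. fst (snd x))) borel g"
    by (simp add: distr_distr comp_def)
  also have "\<dots> = distr waiting_time_law borel g"
    unfolding distr_coordinate distr_time_mark ..
  also have "\<dots> = distr waiting_time_law borel (\<lambda>t. t)"
  proof (rule distr_cong_AE)
    have "AE t in lborel. t \<noteq> (0 :: real)" by (rule AE_lborel_singleton)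
    then show "AE t in waiting_time_law. g t = t"
      unfolding waiting_time_law_def
      by (subst AE_density) (auto simp: g_def exponential_density_def elim!: eventually_mono)
  qed (auto simp: measurable_cong_sets[OF sets_waiting_time refl])
  also have "\<dots> = waiting_time_law" by (rule distr_id2) simp
  finally show ?thesis
    using gap_measurable[of n] unfolding distributed_def waiting_time_law_def by auto
qed

lemma gap_indep: "prob_space.indep_vars path_law (\<lambda>_. borel) gap UNIV"
proof -
  interpret prob_space path_law by (rule prob_space_path)
  have "(\<lambda>x. if 0 < fst (snd x) then fst (snd x) else 1 :: real) \<in> borel_measurable mark_law"
    using time_mark_measurable by measurable
  from indep_vars_compose2[OF indep_coordinates this] show ?thesis
    unfolding gap_def[abs_def] .
qed

text \<open>
  All variables up to the epoch \<open>n\<close> are functions of the first \<open>n\<close> marks. Abstractly, they are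
  measurable for any \<open>\<sigma>\<close>-algebra that makes these marks measurable.
\<close>

context
  fixes A :: "(nat \<Rightarrow> nat \<times> real \<times> real) measure" and n :: nat
  assumes coordinates: "\<And>i. i < n \<Longrightarrow> (\<lambda>\<omega>. \<omega> i) \<in> measurable A mark_law"
begin

lemma jump_time_adapted: "m \<le> n \<Longrightarrow> jump_time m \<in> borel_measurable A"
proof -
  assume m: "m \<le> n"
  have "(\<lambda>\<omega>. gap i \<omega>) \<in> borel_measurable A" if "i < m" for i
  proof -
    have "i < n" using that m by simp
    note [measurable] = measurable_compose[OF coordinates[OF this] time_mark_measurable]
    show ?thesis unfolding gap_def by measurable
  qed
  then show ?thesis unfolding jump_time_def[abs_def] by (intro borel_measurable_sum) auto
qed

lemma jump_spin1_adapted: "m \<le> n \<Longrightarrow> jump_spin1 y m \<in> borel_measurable A"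
proof -
  assume m: "m \<le> n"
  have "(\<lambda>\<omega>. if selected i \<omega> = y then - 1 else 1 :: real) \<in> borel_measurable A" if "i < m" for i
  proof -
    have "(\<lambda>\<omega>. fst (\<omega> i)) \<in> measurable A (count_space {0, 1, 2})"
      using measurable_compose[OF coordinates agent_mark_measurable, of i] that m by simp
    then show ?thesis unfolding selected_def
      by (rule measurable_compose) simp
  qed
  then show ?thesis unfolding jump_spin1_def[abs_def] by (intro borel_measurable_times borel_measurable_prod) auto
qed

lemma jump_plus_adapted: "m \<le> n \<Longrightarrow> (\<lambda>\<omega>. real (jump_plus m \<omega>)) \<in> borel_measurable A"
proof -
  assume m: "m \<le> n"
  note [measurable] = jump_spin1_adapted[OF m]
  have "real (jump_plus m \<omega>) = (\<Sum>y\<in>{0, 1, 2}. if jump_spin1 y m \<omega> = 1 then 1 else 0)" for \<omega>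
    unfolding jump_plus_def by (subst sum.If_cases) (auto simp: Int_def)
  then show ?thesis by simp
qed

lemma step_impact_measurable: "(\<lambda>x. step_impact x M) \<in> borel_measurable borel"
  unfolding step_impact_def by measurable

lemma jump_price_adapted: "m \<le> n \<Longrightarrow> jump_price m \<in> borel_measurable A"
proof (induction m)
  case 0
  have "jump_price 0 = (\<lambda>_. 1)" by (rule ext) simp
  then show ?case by simp
next
  case (Suc m)
  note [measurable] = jump_plus_adapted[OF Suc.prems] jump_plus_adapted[OF Suc_leD[OF Suc.prems]]
    step_impact_measurable
  have [measurable]: "jump_price m \<in> borel_measurable A" using Suc by simp
  show ?case unfolding jump_price.simps[abs_def] by measurable
qed

lemma history_adapted:
  assumes "space A = space path_law"
  shows "sets (history contrarian_market n) \<subseteq> sets A"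
proof (rule history_subset)
  fix Z m
  assume Z: "Z \<in> spin1 contrarian_market ` agents contrarian_market
    \<union> spin2 contrarian_market ` agents contrarian_market \<union> {price contrarian_market}"
  then consider y where "Z = (\<lambda>t \<omega>. jump_spin1 y (jump_index t \<omega>) \<omega>)"
    | y where "Z = (\<lambda>t \<omega>. jump_spin2 y (jump_index t \<omega>))"
    | "Z = (\<lambda>t \<omega>. jump_price (jump_index t \<omega>) \<omega>)"
    by (auto simp: contrarian_market_def)
  note cases = this
  show "piecewise_constant contrarian_market Z"
    using cases piecewise_constant_contrarian[of "\<lambda>n \<omega>. jump_spin2 _ n"]
    by cases (auto intro: piecewise_constant_contrarian)
  assume "m \<le> n"
  with cases show "(\<lambda>\<omega>. Z (epoch contrarian_market m \<omega>) \<omega>) \<in> borel_measurable A"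
    by cases (auto intro: jump_spin1_adapted jump_price_adapted)
next
  fix m assume "m \<le> n"
  then show "epoch contrarian_market m \<in> borel_measurable A" by (simp add: jump_time_adapted)
qed (use assms in \<open>auto simp: jump_time_def\<close>)

end

text \<open>The history up to an epoch depends on earlier marks than the next choice does.\<close>

lemma indep_history_choice:
  "prob_space.indep_set path_law (sets (history contrarian_market n)) (choice_events contrarian_market (Suc n))"
proof -
  interpret prob_space path_law by (rule prob_space_path)
  let ?past = "\<lambda>\<omega> :: nat \<Rightarrow> nat \<times> real \<times> real. restrict \<omega> {..<n}" and ?next = "\<lambda>\<omega> :: nat \<Rightarrow> nat \<times> real \<times> real. restrict \<omega> {n}"
  let ?P = "\<Pi>\<^sub>M i\<in>{..<n}. mark_law" and ?Q = "\<Pi>\<^sub>M i\<in>{n}. mark_law"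
  have "indep_var ?P ?past ?Q ?next"
    using indep_var_restrict[OF indep_coordinates, of "{..<n}" "{n}"] by simp
  then have past: "?past \<in> measurable path_law ?P"
    and indep: "indep_set (sigma_sets (space path_law) {?past -` B \<inter> space path_law | B. B \<in> sets ?P})
      (sigma_sets (space path_law) {?next -` B \<inter> space path_law | B. B \<in> sets ?Q})"
    unfolding indep_var_eq by auto
  define A where "A = vimage_algebra (space path_law) ?past ?P"
  have "(\<lambda>\<omega>. \<omega> i) \<in> measurable A mark_law" if "i < n" for i
  proof -
    have "?past \<in> measurable A ?P"
      unfolding A_def using past by (intro measurable_vimage_algebra1) (auto dest: measurable_space)
    then have "(\<lambda>\<omega>. ?past \<omega> i) \<in> measurable A mark_law"
      by (rule measurable_compose) (use that in \<open>auto intro: measurable_component_singleton\<close>)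
    then show ?thesis using that by simp
  qed
  then have "sets (history contrarian_market n) \<subseteq> sets A"
    by (rule history_adapted) (simp_all add: A_def)
  then have hist: "sets (history contrarian_market n)
      \<subseteq> sigma_sets (space path_law) {?past -` B \<inter> space path_law | B. B \<in> sets ?P}"
    unfolding A_def sets_vimage_algebra .
  have "selected n -` C \<inter> space path_law \<in> {?next -` B \<inter> space path_law | B. B \<in> sets ?Q}"
    if C: "C \<subseteq> {0, 1, 2}" for C
  proof -
    have "(\<lambda>x. x n) \<in> measurable ?Q mark_law"
      by (rule measurable_component_singleton) simp
    then have "(\<lambda>x. fst (x n)) \<in> measurable ?Q (count_space {0, 1, 2})"
      by (rule measurable_compose) (rule agent_mark_measurable)
    then have "(\<lambda>x. fst (x n)) -` C \<inter> space ?Q \<in> sets ?Q"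
      by (rule measurable_sets) (use C in simp)
    moreover have "selected n -` C \<inter> space path_law
        = ?next -` ((\<lambda>x. fst (x n)) -` C \<inter> space ?Q) \<inter> space path_law"
      by (auto simp: selected_def space_path space_PiM PiE_def)
    ultimately show ?thesis by blast
  qed
  then have "choice_events contrarian_market (Suc n)
      \<subseteq> sigma_sets (space path_law) {?next -` B \<inter> space path_law | B. B \<in> sets ?Q}"
    unfolding choice_events_def by (auto intro: sigma_sets.Basic)
  with indep hist show ?thesis
    unfolding indep_sets2_eq by blast
qed

text \<open>The range is the interval from \<open>15 / 14\<close> to \<open>27 / 14\<close>, which contains no integer.\<close>

lemma mixed_range_empty: "mixed_range 1 3 7 = {}"
proof -
  have False if i: "15 / 14 \<le> real i" "real i \<le> 27 / 14" for i
  proof -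
    have "real 1 < real i" "real i < real 2" using i by simp_all
    then show False unfolding of_nat_less_iff by simp
  qed
  then show ?thesis unfolding mixed_range_def by (auto simp: field_simps)
qed

lemma flip_prob_one: "flip_up_prob 1 3 7 1 i s = 1" "flip_down_prob 1 3 7 1 i s = 1"
  by (simp_all add: flip_up_prob_def flip_down_prob_def stay_mm_def stay_pp_def mixed_range_empty
    del: One_nat_def)

lemma jump_spin1_Suc: "jump_spin1 y (Suc n) \<omega> = (if selected n \<omega> = y then - jump_spin1 y n \<omega> else jump_spin1 y n \<omega>)"
  by (simp add: jump_spin1_def)

lemma jump_spin1_values: "jump_spin1 y n \<omega> \<in> {- 1, 1}"
proof (induction n)
  case 0
  then show ?case by (simp add: jump_spin1_def start_spin_def)
next
  case (Suc n)
  then show ?case unfolding jump_spin1_Suc by auto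
qed

lemma jump_spin2_values: "jump_spin2 y n \<in> {- 1, 1}"
  by (cases n) (auto simp: next_spin2_def)

lemma jump_price_pos: "0 < jump_price n \<omega>"
  by (induction n) (auto simp: step_impact_def)

lemma flip_event_always: "flip_event contrarian_market (Suc n) = space path_law"
proof -
  have "jump_spin1 y n \<omega> \<noteq> 0" for y \<omega> using jump_spin1_values[of y n \<omega>] by auto
  then show ?thesis by (simp add: flip_event_def jump_spin1_Suc)
qed

lemma frozen_market_contrarian: "frozen_market 1 3 7 1 step_impact (\<lambda>_. 0) contrarian_market"
proof (rule frozen_market.intro)
  interpret prob_space path_law by (rule prob_space_path)
  have adapted: "(\<lambda>\<omega>. \<omega> i) \<in> measurable path_law mark_law" for i by (rule coordinate_measurable)
  show "mono (\<lambda>x. step_impact x 3)" by (rule monoI) (auto simp: step_impact_def)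
  show "antimono_on {1..} (step_impact x)" for x by (rule monotone_onI) (simp add: step_impact_def)
  show "bij_betw (label contrarian_market) (agents contrarian_market) {1..3}"
    by (auto simp: bij_betw_def image_iff)
  show "prob_space (law contrarian_market)" by (simp add: prob_space_path)
  show "distributed (law contrarian_market) lborel
      (\<lambda>\<omega>. epoch contrarian_market (Suc n) \<omega> - epoch contrarian_market n \<omega>) (exponential_density 1)" for n
    using gap_distributed[of n] by (simp add: jump_time_Suc)
  show "prob_space.indep_vars (law contrarian_market) (\<lambda>_. borel)
      (\<lambda>n \<omega>. epoch contrarian_market (Suc n) \<omega> - epoch contrarian_market n \<omega>) UNIV"
    using gap_indep by (simp add: jump_time_Suc)
  show "(\<lambda>\<omega>. spin1 contrarian_market y (epoch contrarian_market n \<omega>) \<omega>) \<in> borel_measurable (law contrarian_market)" for y n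
    using jump_spin1_adapted[OF adapted order_refl, of y n] by simp
  show "(\<lambda>\<omega>. price contrarian_market (epoch contrarian_market n \<omega>) \<omega>) \<in> borel_measurable (law contrarian_market)" for n
    using jump_price_adapted[OF adapted order_refl, of n] by simp
  show "piecewise_constant contrarian_market (spin1 contrarian_market y)" for y
    using piecewise_constant_contrarian[of "jump_spin1 y"] by (simp add: contrarian_market_def)
  show "piecewise_constant contrarian_market (spin2 contrarian_market y)" for y
    using piecewise_constant_contrarian[of "\<lambda>n _. jump_spin2 y n"] by (simp add: contrarian_market_def)
  show "piecewise_constant contrarian_market (price contrarian_market)"
    using piecewise_constant_contrarian[of jump_price] by (simp add: contrarian_market_def)
  show "piecewise_constant contrarian_market (wealth contrarian_market y)" for y
    using piecewise_constant_contrarian[of "jump_wealth y"] by (simp add: contrarian_market_def)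
  show "spin1 contrarian_market y (epoch contrarian_market n \<omega>) \<omega> \<in> {- 1, 1}" for y n \<omega>
    using jump_spin1_values by simp
  show "spin2 contrarian_market y (epoch contrarian_market n \<omega>) \<omega> \<in> {- 1, 1}" for y n \<omega>
    using jump_spin2_values by simp
  have sel: "selected n \<in> measurable path_law (count_space {0, 1, 2})" for n
    unfolding selected_def[abs_def] by (rule measurable_compose[OF adapted agent_mark_measurable])
  then show "chosen contrarian_market (Suc n)
      \<in> measurable (law contrarian_market) (count_space (agents contrarian_market))" for n
    by simp
  have "distr path_law (count_space {0, 1, 2}) (selected n) = uniform_count_measure {0, 1, 2}" for n
  proof -
    have "distr path_law (count_space {0, 1, 2}) (selected n)
        = distr (distr path_law mark_law (\<lambda>\<omega>. \<omega> n)) (count_space {0, 1, 2}) fst"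
      by (subst distr_distr[OF agent_mark_measurable adapted]) (simp add: selected_def[abs_def] comp_def)
    then show ?thesis unfolding distr_coordinate distr_agent_mark .
  qed
  then show "distr (law contrarian_market) (count_space (agents contrarian_market)) (chosen contrarian_market (Suc n))
      = uniform_count_measure (agents contrarian_market)" for n
    by simp
  show indep: "prob_space.indep_set (law contrarian_market) (sets (history contrarian_market n))
      (choice_events contrarian_market (Suc n))" for n
    using indep_history_choice by simp
  show "AE \<omega> in law contrarian_market. real_cond_exp (law contrarian_market) (history_choice contrarian_market n)
      (indicator (flip_event contrarian_market (Suc n))) \<omega> = flip_prob 1 3 7 1 contrarian_market (Suc n) \<omega>" for n
  proof -
    have "sets (history contrarian_market n) \<union> choice_events contrarian_market (Suc n) \<subseteq> sets path_law"
      using indep_history_choice[of n] unfolding indep_sets2_eq by simp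
    then have "subalgebra path_law (history_choice contrarian_market n)"
      unfolding subalgebra_def history_choice_def
      using sets.sigma_sets_subset[of _ path_law] sets.sets_into_space[of _ path_law]
      by (simp add: space_measure_of_conv) (subst sets_measure_of, auto)
    then interpret G: sigma_finite_subalgebra path_law "history_choice contrarian_market n"
      by (intro finite_measure_subalgebra_is_sigma_finite finite_measure_subalgebra.intro
          finite_measure_subalgebra_axioms.intro finite_measure_axioms)
    have "AE \<omega> in path_law. real_cond_exp path_law (history_choice contrarian_market n)
        (indicator (space path_law)) \<omega> = indicator (space path_law) \<omega>"
    proof (rule G.real_cond_exp_F_meas)
      show "integrable path_law (indicator (space path_law) :: _ \<Rightarrow> real)"
        by (rule integrable_real_indicator) (auto simp: emeasure_eq_measure)
      have "space path_law \<in> sets (history_choice contrarian_market n)"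
        using sets.top[of "history_choice contrarian_market n"] by simp
      then show "indicator (space path_law) \<in> borel_measurable (history_choice contrarian_market n)"
        by (rule borel_measurable_indicator)
    qed
    then show ?thesis
      unfolding contrarian_simps flip_event_always
      using AE_space by eventually_elim (simp add: flip_prob_def flip_prob_one Let_def del: One_nat_def)
  qed
  show "0 < price contrarian_market (epoch contrarian_market n \<omega>) \<omega>" for n \<omega>
    by (simp add: jump_price_pos)
  have plus: "n_plus contrarian_market (jump_time n \<omega>) \<omega> = jump_plus n \<omega>" for n \<omega>
    by (simp add: n_plus_def jump_plus_def)
  show "price contrarian_market (epoch contrarian_market (Suc n) \<omega>) \<omega> - price contrarian_market (epoch contrarian_market n \<omega>) \<omega>
    = price contrarian_market (epoch contrarian_market n \<omega>) \<omega> * step_impact (net_flip contrarian_market (Suc n) \<omega>) 3" for n \<omega>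
    by (simp add: net_flip_def plus algebra_simps)
  show "wealth contrarian_market y 0 \<omega> = 0" for y \<omega>
    using jump_index_jump_time[of 0 \<omega>] by (simp add: jump_time_def)
  show "epoch contrarian_market 0 \<omega> = 0" for \<omega> by (simp add: jump_time_def)
  show "epoch contrarian_market n \<omega> < epoch contrarian_market (Suc n) \<omega>" for n \<omega>
    by (simp add: jump_time_Suc gap_pos)
qed (simp_all add: jump_spin1_Suc step_impact_def)

lemma contrarian_start:
  "in_state contrarian_market (epoch contrarian_market 0 \<omega>) start_spin (\<lambda>_. 1) \<omega>"
  by (simp add: in_state_def jump_spin1_def)

text \<open>
  Agents \<open>0\<close> and \<open>1\<close> are buyers and agent \<open>2\<close> is a seller; each is chosen with probability \<open>1 / 3\<close>
  and then flips. A buyer sees a gain of \<open>1 / 4\<close> from the seller and a loss of \<open>1 / 2\<close> from the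
  other buyer, hence expects \<open>- 1 / 12\<close>. The seller profits from the flip of either buyer and
  expects \<open>1 / 3\<close>. So the market gains \<open>1 / 6\<close> on average while two agents out of three expect a
  loss.
\<close>

lemma contrarian_disagreement:
  "AE \<omega> in path_law. opposite_signs (market_drift contrarian_market 1 \<omega>) (majority_opinion contrarian_market 1 \<omega>)"
proof -
  interpret frozen_market 1 3 7 1 step_impact "\<lambda>_. 0" contrarian_market by (rule frozen_market_contrarian)
  have h: "price_response 3 step_impact contrarian_market 0 j \<omega> * site_flip_prob 1 3 7 1 contrarian_market 0 j \<omega>
      = (if j = 2 then 1 / 4 else - 1 / 2)" for j \<omega>
    by (simp add: price_response_def site_flip_prob_def flip_prob_one Let_def jump_spin1_def start_spin_def step_impact_def
        del: One_nat_def)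
  have "expected_gain 0 0 \<omega> = - 1 / 12" "expected_gain 0 1 \<omega> = - 1 / 12" "expected_gain 0 2 \<omega> = 1 / 3" for \<omega>
    unfolding expected_gain_def h by (simp_all add: jump_spin1_def start_spin_def insert_Diff_if)
  then have sums: "(\<Sum>y\<in>{0, 1, 2}. expected_gain 0 y \<omega>) = 1 / 6"
      "(\<Sum>y\<in>{0, 1, 2}. sgn (expected_gain 0 y \<omega>)) = - 1" for \<omega>
    by (simp_all del: One_nat_def times_divide_eq_left eq_divide_eq_numeral1 eq_divide_eq_1)
  show ?thesis
    using market_drift_expected_gain[of 0] majority_opinion_expected_gain[of 0]
    unfolding contrarian_simps One_nat_def[symmetric]
    by eventually_elim (simp only: sums opposite_signs_def, simp)
qed

lemma market_disagrees_with_majority: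
  "\<exists>(d' :: nat) (N' :: nat) (\<alpha>' :: real) (q' :: real) (f' :: real \<Rightarrow> nat \<Rightarrow> real) (K' :: nat \<Rightarrow> real)
          (S' :: (nat \<Rightarrow> nat \<times> real \<times> real, nat) spin_market) (k' :: nat)
          (e1 :: nat \<Rightarrow> real) (e2 :: nat \<Rightarrow> real).
          frozen_market d' N' \<alpha>' q' f' K' S' \<and> 1 \<le> k' \<and>
          0 < measure (law S') {\<omega> \<in> space (law S'). in_state S' (epoch S' (k' - 1) \<omega>) e1 e2 \<omega>} \<and>
          (AE \<omega> in law S'. in_state S' (epoch S' (k' - 1) \<omega>) e1 e2 \<omega>
             \<longrightarrow> opposite_signs (market_drift S' k' \<omega>) (majority_opinion S' k' \<omega>))"
proof -
  have "{\<omega> \<in> space path_law. in_state contrarian_market (epoch contrarian_market (1 - 1) \<omega>) start_spin (\<lambda>_. 1) \<omega>}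
      = space path_law"
    using contrarian_start by simp
  then have "0 < measure (law contrarian_market) {\<omega> \<in> space (law contrarian_market).
      in_state contrarian_market (epoch contrarian_market (1 - 1) \<omega>) start_spin (\<lambda>_. 1) \<omega>}"
    using prob_space.prob_space[OF prob_space_path] by simp
  moreover have "AE \<omega> in law contrarian_market.
      in_state contrarian_market (epoch contrarian_market (1 - 1) \<omega>) start_spin (\<lambda>_. 1) \<omega> \<longrightarrow>
      opposite_signs (market_drift contrarian_market 1 \<omega>) (majority_opinion contrarian_market 1 \<omega>)"
    using contrarian_disagreement unfolding contrarian_simps by eventually_elim blast
  ultimately have "frozen_market 1 3 7 1 step_impact (\<lambda>_. 0) contrarian_market \<and> (1 :: nat) \<le> 1
      \<and> 0 < measure (law contrarian_market) {\<omega> \<in> space (law contrarian_market).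
          in_state contrarian_market (epoch contrarian_market (1 - 1) \<omega>) start_spin (\<lambda>_. 1) \<omega>}
      \<and> (AE \<omega> in law contrarian_market.
          in_state contrarian_market (epoch contrarian_market (1 - 1) \<omega>) start_spin (\<lambda>_. 1) \<omega> \<longrightarrow>
          opposite_signs (market_drift contrarian_market 1 \<omega>) (majority_opinion contrarian_market 1 \<omega>))"
    using frozen_market_contrarian by blast
  then show ?thesis by (intro exI)
qed

theorem theorem4p1:
  fixes d N :: nat and \<alpha> q :: real and f :: "real \<Rightarrow> nat \<Rightarrow> real"
    and K :: "'a \<Rightarrow> real" and S :: "('w, 'a) spin_market" and k :: nat
  shows
    "(frozen_market d N \<alpha> q f K S \<and> 1 \<le> k \<longrightarrow>
        (AE \<omega> in law S. market_drift S k \<omega> \<le> 0 \<longrightarrow> majority_opinion S k \<omega> \<le> 0))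
     \<and> (\<exists>(d' :: nat) (N' :: nat) (\<alpha>' :: real) (q' :: real) (f' :: real \<Rightarrow> nat \<Rightarrow> real) (K' :: nat \<Rightarrow> real)
          (S' :: (nat \<Rightarrow> nat \<times> real \<times> real, nat) spin_market) (k' :: nat)
          (e1 :: nat \<Rightarrow> real) (e2 :: nat \<Rightarrow> real).
          frozen_market d' N' \<alpha>' q' f' K' S' \<and> 1 \<le> k' \<and>
          0 < measure (law S') {\<omega> \<in> space (law S'). in_state S' (epoch S' (k' - 1) \<omega>) e1 e2 \<omega>} \<and>
          (AE \<omega> in law S'. in_state S' (epoch S' (k' - 1) \<omega>) e1 e2 \<omega>
             \<longrightarrow> opposite_signs (market_drift S' k' \<omega>) (majority_opinion S' k' \<omega>)))
     \<and> (frozen_market d N \<alpha> q f K S \<and> 1 \<le> k \<longrightarrow>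
        (AE \<omega> in law S. opposite_signs (market_drift S k \<omega>) (majority_opinion S k \<omega>)
           \<longrightarrow> 0 \<le> market_drift S k \<omega>))"
proof (intro conjI impI)
  assume "frozen_market d N \<alpha> q f K S \<and> 1 \<le> k"
  then show supermartingale: "AE \<omega> in law S. market_drift S k \<omega> \<le> 0 \<longrightarrow> majority_opinion S k \<omega> \<le> 0"
    using frozen_market.supermartingale_majority by blast
  then show "AE \<omega> in law S. opposite_signs (market_drift S k \<omega>) (majority_opinion S k \<omega>)
           \<longrightarrow> 0 \<le> market_drift S k \<omega>"
    by eventually_elim (auto simp: opposite_signs_def)
qed (rule market_disagrees_with_majority)

end
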